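(* Let $A\subset\mathbb{R}^m$ be a finite set whose convex hull $P=\mathrm{conv}(A)$ has dimension $m$, let $\alpha_a>0$ for $a\in A$, let $a_0\in\mathbb{R}^m\setminus A$ and $\alpha_0>0$. Let $\mathcal{E}(x)=\sum_{a\in A}\xi_a\alpha_ae^{\langle a,x\rangle}$ and $\mathcal{E}_0(x)=\mathcal{E}(x)+\xi_0\alpha_0e^{\langle a_0,x\rangle}$, where $\xi_0$ and $\xi_a$ ($a\in A$) are independent standard real Gaussian variables. If $a_0\in\mathrm{int}(P)$, then there is a non-empty open set $U\subset\mathbb{R}^m$ such that $$\mathbb{E}\mathbb{S}\{\mathcal{E}_0;U\}<\mathbb{E}\mathbb{S}\{\mathcal{E};U\}.$$
   Context: For a random function $\mathcal{X}:\mathbb{R}^m\to\mathbb{R}$ and an open set $U\subset\mathbb{R}^m$, $\mathbb{E}\mathbb{S}\{\mathcal{X};U\}$ denotes the expected number of points $x\in U$ with $\mathcal{X}_1(x)=\dots=\mathcal{X}_m(x)=0$, where $\mathcal{X}_1,\dots,\mathcal{X}_m$ are i.i.d. copies of $\mathcal{X}$. *)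

theory Defs
  imports "HOL-Probability.Probability"
begin

text \<open>
  The i.i.d. copies of a random function \<open>X\<close> on the probability space \<open>M\<close> are realised on the
  product space \<open>M\<^sup>m\<close>, the \<open>i\<close>-th copy being \<open>\<omega> \<mapsto> X (\<omega> i)\<close>. The index type \<open>'n\<close> of the
  coordinates also indexes the copies, so that there are \<open>m = CARD('n)\<close> equations in \<open>m\<close> unknowns.
  Zeros are counted in \<open>ennreal\<close>: the count is \<open>\<infinity>\<close> if there are infinitely many of them.
\<close>

definition ES :: "'w measure \<Rightarrow> ('w \<Rightarrow> real ^ 'n \<Rightarrow> real) \<Rightarrow> (real ^ 'n) set \<Rightarrow> ennreal" where
  "ES M X U = (\<integral>\<^sup>+ \<omega>. emeasure (count_space UNIV) {x \<in> U. \<forall>i. X (\<omega> i) x = 0}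
                 \<partial>(\<Pi>\<^sub>M i\<in>(UNIV :: 'n set). M))"

definition exp_sum ::
    "(real ^ 'n) set \<Rightarrow> (real ^ 'n \<Rightarrow> real) \<Rightarrow> (real ^ 'n \<Rightarrow> 'w \<Rightarrow> real) \<Rightarrow> 'w \<Rightarrow> real ^ 'n \<Rightarrow> real" where
  "exp_sum A \<alpha> \<xi> \<omega> x = (\<Sum>a\<in>A. \<xi> a \<omega> * \<alpha> a * exp (a \<bullet> x))"

end

theory Submission
  imports Defs
begin

text \<open>
  The zeros of a Gaussian exponential sum have a density of Kac--Rice type. With
  \<open>v\<^sub>a = \<alpha>\<^sub>a exp (a \<bullet> x)\<close>, \<open>K = \<Sum> v\<^sub>a\<^sup>2\<close>, \<open>\<mu> = \<Sum> v\<^sub>a\<^sup>2 a / K\<close> and independent standard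
  Gaussian vectors \<open>w\<^sub>a\<close> in dimension \<open>m\<close>, the density at \<open>x\<close> is
  \<open>(2 \<pi> K) powr (- m / 2)\<close> times the mean of \<open>\<bar>det (\<Sum> v\<^sub>a w\<^sub>a \<otimes> (a - \<mu>))\<bar>\<close>.
  It comes from dividing the system by one exponential, which turns the zeros into the preimages of
  a Gaussian vector under a smooth map, so that the area formula and a Gaussian change of
  variables apply.

  Since \<open>a\<^sub>0\<close> is an interior point of the hull, there is a point \<open>x\<close> with \<open>\<mu> = a\<^sub>0\<close>. At this point
  the additional term with exponent \<open>a\<^sub>0\<close> changes neither \<open>\<mu>\<close> nor the determinant but increases
  \<open>K\<close>, so the density strictly decreases. By continuity it decreases on a small ball.
\<close>

subsection \<open>Reindexing of coordinates\<close>

text \<open>Dividing by the exponential of a chosen exponent \<open>b\<close> is convenient but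
  breaks the symmetry: the area formula returns a density attached to \<open>b\<close>, in which the
  sums with and without \<open>a\<^sub>0\<close> are hard to compare. The centred vectors
  \<open>a - \<mu>\<close> remove \<open>b\<close>. Here \<mu> is the regression coefficient of the
  gradient of the exponential sum on its value, so the centred Jacobian is independent of the value
  and conditioning on a zero leaves no trace. Only in this form does an exponent equal to \<mu> drop
  out of the determinant.

  No genericity of the zeros is assumed.

  A strict decrease also requires the mean absolute determinant to be finite and positive at the
  chosen point. Positivity holds because no non-zero direction is orthogonal to all
  \<open>a - a\<^sub>0\<close> when \<open>a\<^sub>0\<close> is interior to the hull.\<close>

text \<open>
  The library's change of variables theorem requires a well-ordered index type; this is a copy of
  an arbitrary finite index type with an order transported from the natural numbers.
\<close>

typedef 'n wo_idx = "UNIV :: 'n set"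
  morphisms of_wo to_wo ..

instance wo_idx :: (finite) finite
proof
  have "(UNIV :: 'a wo_idx set) = range to_wo"
    using type_definition.univ[OF type_definition_wo_idx] by simp
  also have "finite \<dots>" by simp
  finally show "finite (UNIV :: 'a wo_idx set)" .
qed

instantiation wo_idx :: (finite) wellorder
begin

definition less_eq_wo_idx :: "'a wo_idx \<Rightarrow> 'a wo_idx \<Rightarrow> bool" where
  "less_eq_wo_idx x y \<longleftrightarrow> to_nat (of_wo x) \<le> to_nat (of_wo y)"

definition less_wo_idx :: "'a wo_idx \<Rightarrow> 'a wo_idx \<Rightarrow> bool" where
  "less_wo_idx x y \<longleftrightarrow> to_nat (of_wo x) < to_nat (of_wo y)"

instance
proof
  fix x y z :: "'a wo_idx"
  show "x < y \<longleftrightarrow> x \<le> y \<and> \<not> y \<le> x" and "x \<le> x" and "x \<le> y \<or> y \<le> x"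
    by (auto simp: less_eq_wo_idx_def less_wo_idx_def)
  show "x \<le> z" if "x \<le> y" "y \<le> z"
    using that by (simp add: less_eq_wo_idx_def)
  show "x = y" if "x \<le> y" "y \<le> x"
    using that by (simp add: less_eq_wo_idx_def of_wo_inject)
next
  fix P :: "'a wo_idx \<Rightarrow> bool" and a :: "'a wo_idx"
  assume *: "\<And>x. (\<And>y. y < x \<Longrightarrow> P y) \<Longrightarrow> P x"
  show "P a"
    by (induction "to_nat (of_wo a)" arbitrary: a rule: less_induct)
       (rule *, simp add: less_wo_idx_def)
qed

end

lemma bij_of_wo: "bij (of_wo :: 'n wo_idx \<Rightarrow> 'n)"
  using type_definition.Rep_range[OF type_definition_wo_idx]
  by (auto simp: bij_def inj_def of_wo_inject)

text \<open>Conjugation by \<open>f\<close> is a sign-preserving bijection between the permutations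
  of the two index types, so the two Leibniz expansions agree term by term.\<close>

lemma det_reindex:
  fixes A :: "real ^ 'n ^ 'n" and f :: "'k::finite \<Rightarrow> 'n"
  assumes f: "bij f"
  shows "det (\<chi> i j. A $ f i $ f j) = det A"
proof -
  let ?m = "map_permutation UNIV f"
  have inj: "inj f" using f by (rule bij_is_inj)
  have bb: "bij_betw ?m {p. p permutes UNIV} {p. p permutes UNIV}"
  proof (rule bij_betwI[where g="map_permutation UNIV (inv f)"])
    have bi: "bij (inv f)" using f by (rule bij_imp_bij_inv)
    show "?m \<in> {p. p permutes UNIV} \<rightarrow> {p. p permutes UNIV}"
      using map_permutation_permutes[of f UNIV UNIV] f by (auto simp: bij_betw_def)
    show "map_permutation UNIV (inv f) \<in> {p. p permutes UNIV} \<rightarrow> {p. p permutes UNIV}"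
      using map_permutation_permutes[of "inv f" UNIV UNIV] bi by (auto simp: bij_betw_def)
    fix p :: "'k \<Rightarrow> 'k"
    show "map_permutation UNIV (inv f) (?m p) = p"
    proof
      fix x
      have "map_permutation UNIV (inv f) (?m p) (inv f (f x)) = inv f (?m p (f x))"
        by (rule map_permutation_apply) (use bi in \<open>auto simp: bij_is_inj\<close>)
      also have "?m p (f x) = f (p x)"
        by (rule map_permutation_apply) (use inj in auto)
      finally show "map_permutation UNIV (inv f) (?m p) x = p x" using inj by simp
    qed
  next
    fix q :: "'n \<Rightarrow> 'n"
    have bi: "bij (inv f)" using f by (rule bij_imp_bij_inv)
    show "?m (map_permutation UNIV (inv f) q) = q"
    proof
      fix y
      have "?m (map_permutation UNIV (inv f) q) (f (inv f y)) = f (map_permutation UNIV (inv f) q (inv f y))"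
        by (rule map_permutation_apply) (use inj in auto)
      also have "map_permutation UNIV (inv f) q (inv f y) = inv f (q y)"
        by (rule map_permutation_apply) (use bi in \<open>auto simp: bij_is_inj\<close>)
      finally show "?m (map_permutation UNIV (inv f) q) y = q y"
        using f by (simp add: bij_is_surj surj_f_inv_f)
    qed
  qed
  have "det A = (\<Sum>p\<in>{p. p permutes UNIV}. of_int (sign (?m p)) * (\<Prod>i\<in>UNIV. A $ i $ ?m p i))"
    unfolding det_def by (rule sum.reindex_bij_betw[OF bb, symmetric])
  also have "\<dots> = (\<Sum>p\<in>{p. p permutes UNIV}. of_int (sign p) * (\<Prod>i\<in>UNIV. A $ f i $ f (p i)))"
  proof (rule sum.cong[OF refl], goal_cases)
    case (1 p)
    have "(\<Prod>i\<in>UNIV. A $ i $ ?m p i) = (\<Prod>i\<in>UNIV. A $ f i $ ?m p (f i))"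
      by (rule prod.reindex_bij_betw[OF f, symmetric])
    also have "\<dots> = (\<Prod>i\<in>UNIV. A $ f i $ f (p i))"
      using map_permutation_apply[of f UNIV _ p] inj by simp
    finally show ?case
      using sign_map_permutation[of f UNIV p] inj 1 by simp
  qed
  also have "\<dots> = det (\<chi> i j. A $ f i $ f j)" by (simp add: det_def)
  finally show ?thesis by simp
qed

lemma prod_Basis_vec:
  "(\<Prod>b\<in>(Basis :: (real^'n) set). f b) = (\<Prod>i\<in>UNIV. f (axis i 1))"
proof -
  have B: "(Basis :: (real^'n) set) = range (\<lambda>i. axis i 1)"
    by (auto simp: Basis_vec_def)
  have inj: "inj (\<lambda>i. axis i 1 :: real^'n)"
    by (auto simp: inj_on_def axis_eq_axis)
  show ?thesis unfolding B by (subst prod.reindex[OF inj]) (simp add: o_def)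
qed

lemma lborel_distr_reindex:
  fixes f :: "'k::finite \<Rightarrow> 'n::finite"
  assumes f: "bij f"
  shows "distr lborel borel (\<lambda>x::real^'n. \<chi> i. x $ f i) = (lborel :: (real^'k) measure)"
proof (rule lborel_eqI[symmetric])
  fix l u :: "real^'k"
  assume lu: "\<And>b. b \<in> Basis \<Longrightarrow> l \<bullet> b \<le> u \<bullet> b"
  have meas: "(\<lambda>x::real^'n. \<chi> i. x $ f i) \<in> borel_measurable borel"
    by (intro borel_measurable_continuous_onI continuous_intros)
  have le: "l $ i \<le> u $ i" for i
    using lu[of "axis i 1"] by (simp add: inner_axis)
  let ?l = "\<chi> j. l $ inv f j" and ?u = "\<chi> j. u $ inv f j"
  have inv1: "inv f (f i) = i" for i using f by (simp add: bij_is_inj)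
  have inv2: "f (inv f i) = i" for i using f by (simp add: bij_is_surj surj_f_inv_f)
  have "(\<lambda>x::real^'n. \<chi> i. x $ f i) -` box l u = box ?l ?u"
  proof (rule set_eqI)
    fix x :: "real^'n"
    have "(\<forall>i. l $ i < x $ f i \<and> x $ f i < u $ i) \<longleftrightarrow> (\<forall>j. l $ inv f j < x $ j \<and> x $ j < u $ inv f j)"
      by (metis inv1 inv2)
    then show "x \<in> (\<lambda>x::real^'n. \<chi> i. x $ f i) -` box l u \<longleftrightarrow> x \<in> box ?l ?u"
      by (simp add: mem_box_cart)
  qed
  then have "emeasure (distr lborel borel (\<lambda>x::real^'n. \<chi> i. x $ f i)) (box l u) = emeasure lborel (box ?l ?u)"
    using meas by (subst emeasure_distr) auto
  also have "\<dots> = ennreal (\<Prod>b\<in>Basis. (?u - ?l) \<bullet> b)"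
  proof (rule emeasure_lborel_box)
    fix b :: "real^'n" assume "b \<in> Basis"
    then obtain j where "b = axis j 1" by (auto simp: Basis_vec_def)
    then show "?l \<bullet> b \<le> ?u \<bullet> b" using le[of "inv f j"] by (simp add: inner_axis)
  qed
  also have "(\<Prod>b\<in>Basis. (?u - ?l) \<bullet> b) = (\<Prod>j\<in>UNIV. (?u - ?l) $ j)"
    unfolding prod_Basis_vec by (simp add: inner_axis)
  also have "(\<Prod>j\<in>UNIV. (?u - ?l) $ j) = (\<Prod>i\<in>UNIV. (?u - ?l) $ f i)"
    by (rule prod.reindex_bij_betw[OF f, symmetric])
  also have "\<dots> = (\<Prod>i\<in>UNIV. (u - l) $ i)"
    by (rule prod.cong[OF refl]) (simp only: vector_minus_component vec_lambda_beta inv1)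
  also have "\<dots> = (\<Prod>b\<in>Basis. (u - l) \<bullet> b)"
    unfolding prod_Basis_vec by (simp add: inner_axis)
  finally show "emeasure (distr lborel borel (\<lambda>x::real^'n. \<chi> i. x $ f i)) (box l u) = ennreal (\<Prod>b\<in>Basis. (u - l) \<bullet> b)" .
qed simp

subsection \<open>The area formula\<close>

lemma nn_integral_change_of_variables_inj:
  fixes g :: "real^'m::{finite,wellorder} \<Rightarrow> real^'m::_"
  assumes S: "S \<in> sets lebesgue"
    and der: "\<And>x. x \<in> S \<Longrightarrow> (g has_derivative (*v) (J x)) (at x within S)"
    and inj: "inj_on g S"
    and \<phi>: "integrable lborel \<phi>" "\<And>x. 0 \<le> \<phi> x"
  shows "(\<integral>\<^sup>+y. ennreal (\<phi> y) * indicator (g ` S) y \<partial>lborel) =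
         (\<integral>\<^sup>+x. ennreal (\<bar>det (J x)\<bar> * \<phi> (g x)) * indicator S x \<partial>lborel)"
proof -
  have gS: "g ` S \<in> sets lebesgue"
    using der by (intro differentiable_image_in_sets_lebesgue[OF S])
      (auto simp: differentiable_on_def differentiable_def)
  have "integrable lebesgue \<phi>"
    using \<phi>(1) by (simp add: integrable_completion)
  then have abs: "\<phi> absolutely_integrable_on (g ` S)"
    unfolding set_integrable_def by (rule integrable_mult_indicator[OF gS])
  define b where "b = integral (g ` S) \<phi>"
  \<comment> \<open>The change of variables theorem speaks of vector-valued integrands, so
    \<open>\<phi>\<close> is passed through \<open>real^1\<close>.\<close>
  have "(\<lambda>x. \<bar>det (matrix ((*v) (J x)))\<bar> *\<^sub>R (vec (\<phi> (g x)) :: real^1)) absolutely_integrable_on S \<and>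
        integral S (\<lambda>x. \<bar>det (matrix ((*v) (J x)))\<bar> *\<^sub>R (vec (\<phi> (g x)) :: real^1)) = vec b"
    using abs by (subst has_absolute_integral_change_of_variables[OF S der inj, where f="\<lambda>y. vec (\<phi> y)"])
      (auto simp: absolutely_integrable_on_1_iff integral_on_1_eq b_def)
  then have "((\<lambda>x. \<bar>det (J x)\<bar> * \<phi> (g x)) has_integral b) S"
    by (auto simp: absolutely_integrable_on_1_iff integral_on_1_eq has_integral_iff vec_eq_iff
        set_lebesgue_integral_eq_integral(1))
  then have "(\<integral>\<^sup>+x. ennreal (\<bar>det (J x)\<bar> * \<phi> (g x)) * indicator S x \<partial>lborel) = ennreal b"
    using \<phi>(2) by (intro nn_integral_has_integral_lebesgue') auto
  moreover have "(\<phi> has_integral b) (g ` S)"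
    using abs by (simp add: b_def has_integral_iff set_lebesgue_integral_eq_integral(1))
  then have "(\<integral>\<^sup>+y. ennreal (\<phi> y) * indicator (g ` S) y \<partial>lborel) = ennreal b"
    using \<phi>(2) by (intro nn_integral_has_integral_lebesgue') auto
  ultimately show ?thesis by simp
qed

lemma locally_injective_at_regular_point:
  fixes g :: "real^'m \<Rightarrow> real^'m"
  assumes der: "\<And>x. (g has_derivative (*v) (J x)) (at x)"
    and cont: "continuous_on UNIV J" and reg: "det (J a) \<noteq> 0"
  obtains r where "r > 0" "inj_on g (ball a r)"
proof -
  obtain B where B: "B ** J a = mat 1"
    using reg by (metis invertible_det_nz invertible_def)
  show thesis
  proof (rule has_derivative_locally_injective[of a UNIV "(*v) B" "\<lambda>x. (*v) (J x)" g])
    show "bounded_linear ((*v) B)" by simp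
    show "(*v) B \<circ> (*v) (J a) = id"
      by (auto simp: o_def matrix_vector_mul_assoc B)
    fix e :: real assume e: "e > 0"
    \<comment> \<open>The sum of the absolute entries bounds the operator norm, so continuity of
      \<open>J\<close> yields continuity of the derivative in \<open>onorm\<close>.\<close>
    let ?h = "\<lambda>x. \<Sum>i\<in>UNIV. \<Sum>j\<in>UNIV. \<bar>(J x - J a) $ i $ j\<bar>"
    have "continuous_on UNIV ?h"
      by (intro continuous_intros cont)
    then have "isCont ?h a" by (simp add: continuous_on_eq_continuous_at)
    then obtain d where d: "d > 0" "\<And>x. dist x a < d \<Longrightarrow> dist (?h x) (?h a) < e"
      using e unfolding continuous_at_eps_delta by metis
    show "\<exists>d>0. \<forall>x. dist a x < d \<longrightarrow> onorm (\<lambda>v. J x *v v - J a *v v) < e"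
    proof (intro exI[of _ d] conjI allI impI)
      fix x assume x: "dist a x < d"
      have "onorm (\<lambda>v. J x *v v - J a *v v) = onorm ((*v) (J x - J a))"
        by (rule arg_cong[where f=onorm], rule ext) (simp add: matrix_vector_mult_diff_rdistrib)
      also have "\<dots> \<le> ?h x" by (rule onorm_le_matrix_component_sum)
      also have "\<dots> < e"
        using d(2)[of x] x by (simp add: dist_commute dist_real_def)
      finally show "onorm (\<lambda>v. J x *v v - J a *v v) < e" .
    qed fact
  qed (use der that in auto)
qed

text \<open>Critical points contribute to neither side: their image is negligible by Sard's theorem,
  and the determinant vanishes there. The regular points are cut into countably many disjoint Borel
  pieces on which \<open>g\<close> is injective. On each piece the count is an indicator, and the
  injective change of variables applies.\<close>

lemma area_formula_wellorder:
  fixes g :: "real^'m::{finite,wellorder} \<Rightarrow> real^'m::_"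
  assumes U: "open U"
    and der: "\<And>x. (g has_derivative (*v) (J x)) (at x)"
    and cont: "continuous_on UNIV J"
    and \<phi>: "integrable lborel \<phi>" "\<And>x. 0 \<le> \<phi> x"
  shows "(\<integral>\<^sup>+y. ennreal (\<phi> y) * emeasure (count_space UNIV) {x\<in>U. g x = y} \<partial>lborel) =
         (\<integral>\<^sup>+x. ennreal (\<bar>det (J x)\<bar> * \<phi> (g x)) * indicator U x \<partial>lborel)"
proof -
  define R where "R = {x\<in>U. det (J x) \<noteq> 0}"
  have detc: "continuous_on UNIV (\<lambda>x. det (J x))"
    unfolding det_def by (intro continuous_intros cont)
  have "open {x. det (J x) \<noteq> 0}"
    using open_vimage[OF open_Compl[OF closed_singleton] detc, of 0] by (simp add: vimage_def)
  then have "open (U \<inter> {x. det (J x) \<noteq> 0})" using U by blast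
  then have R: "R \<in> sets borel" unfolding R_def by (auto simp: Int_def)
  define \<F> where "\<F> = {ball x r | x r. x \<in> R \<and> 0 < r \<and> inj_on g (ball x r)}"
  have "\<And>S. S \<in> \<F> \<Longrightarrow> open S" by (auto simp: \<F>_def)
  then obtain \<F>' where \<F>': "\<F>' \<subseteq> \<F>" "countable \<F>'" "\<Union>\<F>' = \<Union>\<F>"
    by (rule Lindelof)
  have R_sub: "R \<subseteq> \<Union>\<F>"
  proof
    fix x assume x: "x \<in> R"
    then obtain r where "r > 0" "inj_on g (ball x r)"
      using locally_injective_at_regular_point[OF der cont, of x] by (auto simp: R_def)
    with x show "x \<in> \<Union>\<F>" unfolding \<F>_def by (force intro!: exI[of _ "ball x r"])
  qed
  \<comment> \<open>The empty set is added because enumerating by \<open>from_nat_into\<close> with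
    full range requires a non-empty family.\<close>
  define C where "C = from_nat_into (insert {} \<F>')"
  have rangeC: "range C = insert {} \<F>'"
    unfolding C_def using \<F>'(2) by (intro range_from_nat_into) auto
  have C: "open (C k)" "inj_on g (C k)" for k
  proof -
    have "C k \<in> insert {} \<F>'" using rangeC by blast
    then show "open (C k)" "inj_on g (C k)" using \<F>'(1) by (auto simp: \<F>_def)
  qed
  define D where "D k = R \<inter> disjointed C k" for k
  have "range C \<subseteq> sets borel" using C by auto
  then have "disjointed C k \<in> sets borel" for k
    using sets.range_disjointed_sets[of C borel] by auto
  with R have D: "D k \<in> sets borel" for k by (auto simp: D_def)
  then have D': "D k \<in> sets lebesgue" for k by (simp add: sets_completionI_sets)
  have disj: "disjoint_family D"
    using disjoint_family_disjointed[of C] by (auto simp: D_def disjoint_family_on_def)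
  have UND: "(\<Union>k. D k) = R"
  proof -
    have "(\<Union>k. D k) = R \<inter> (\<Union>k. C k)"
      by (simp only: D_def Int_UN_distrib[symmetric] UN_disjointed_eq)
    moreover have "(\<Union>k. C k) = \<Union>\<F>" unfolding rangeC \<F>'(3)[symmetric] by simp
    ultimately show ?thesis using R_sub by (simp only: Int_absorb2)
  qed
  have injD: "inj_on g (D k)" for k
    using C(2)[of k] disjointed_subset[of C k] by (auto simp: D_def intro: inj_on_subset)
  have gD: "g ` D k \<in> sets lebesgue" for k
    using der by (intro differentiable_image_in_sets_lebesgue[OF D'])
      (auto simp: differentiable_on_def differentiable_def intro: has_derivative_at_withinI)
  have "negligible (g ` (U - R))"
  proof (rule baby_Sard[where f'="\<lambda>x. (*v) (J x)"])
    fix x assume "x \<in> U - R"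
    then have "det (J x) = 0" by (simp add: R_def)
    then show "rank (matrix ((*v) (J x))) < CARD('m)" by (simp add: det_eq_0_rank)
  qed (use der in \<open>auto intro: has_derivative_at_withinI\<close>)
  \<comment> \<open>The argument runs in the completed measure because the images of the pieces
    \<open>D k\<close> are only known to be Lebesgue measurable.\<close>
  then have "AE y in lebesgue. y \<notin> g ` (U - R)"
    by (auto simp: negligible_iff_null_sets intro: AE_not_in)
  then have ae: "AE y in lebesgue. ennreal (\<phi> y) * emeasure (count_space UNIV) {x\<in>U. g x = y} =
      (\<Sum>k. ennreal (\<phi> y) * indicator (g ` D k) y)"
  proof eventually_elim
    case (elim y)
    then have "{x\<in>U. g x = y} = (\<Union>k. {x\<in>D k. g x = y})"
      using UND by (auto simp: R_def)
    also have "emeasure (count_space UNIV) \<dots> = (\<Sum>k. emeasure (count_space UNIV) {x\<in>D k. g x = y})"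
      using disj by (intro suminf_emeasure[symmetric]) (auto simp: disjoint_family_on_def)
    also have "\<dots> = (\<Sum>k. indicator (g ` D k) y)"
    proof (rule suminf_cong)
      fix k
      show "emeasure (count_space UNIV) {x\<in>D k. g x = y} = indicator (g ` D k) y"
      proof (cases "y \<in> g ` D k")
        case True
        then obtain x where "x \<in> D k" "g x = y" by auto
        then have *: "{x\<in>D k. g x = y} = {x}" using injD[of k] by (auto simp: inj_on_def)
        show ?thesis unfolding * using True by simp
      next
        case False
        then have *: "{x\<in>D k. g x = y} = {}" by auto
        show ?thesis unfolding * using False by simp
      qed
    qed
    finally show ?case by simp
  qed
  have [measurable]: "\<phi> \<in> borel_measurable borel" using \<phi>(1) by auto
  have "g \<in> borel_measurable borel"
    using der by (intro borel_measurable_continuous_onI)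
      (meson continuous_at_imp_continuous_on has_derivative_continuous)
  note [measurable] = this
  have [measurable]: "(\<lambda>x. det (J x)) \<in> borel_measurable borel"
    using detc by (rule borel_measurable_continuous_onI)
  have [measurable]: "(\<lambda>y. ennreal (\<phi> y) * indicator (g ` D k) y) \<in> borel_measurable lebesgue" for k
  proof -
    have [measurable]: "\<phi> \<in> borel_measurable lebesgue"
      by (intro measurable_completion) simp
    show ?thesis using gD[of k] by measurable
  qed
  have "(\<integral>\<^sup>+y. ennreal (\<phi> y) * emeasure (count_space UNIV) {x\<in>U. g x = y} \<partial>lborel) =
      (\<integral>\<^sup>+y. ennreal (\<phi> y) * emeasure (count_space UNIV) {x\<in>U. g x = y} \<partial>lebesgue)"
    by (simp add: nn_integral_completion)
  also have "\<dots> = (\<integral>\<^sup>+y. (\<Sum>k. ennreal (\<phi> y) * indicator (g ` D k) y) \<partial>lebesgue)"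
    using ae by (rule nn_integral_cong_AE)
  also have "\<dots> = (\<Sum>k. \<integral>\<^sup>+y. ennreal (\<phi> y) * indicator (g ` D k) y \<partial>lebesgue)"
    by (rule nn_integral_suminf) measurable
  also have "\<dots> = (\<Sum>k. \<integral>\<^sup>+x. ennreal (\<bar>det (J x)\<bar> * \<phi> (g x)) * indicator (D k) x \<partial>lborel)"
    unfolding nn_integral_completion
    by (intro suminf_cong nn_integral_change_of_variables_inj D' injD \<phi>)
       (use der in \<open>auto intro: has_derivative_at_withinI\<close>)
  also have "\<dots> = (\<integral>\<^sup>+x. (\<Sum>k. ennreal (\<bar>det (J x)\<bar> * \<phi> (g x)) * indicator (D k) x) \<partial>lborel)"
    by (intro nn_integral_suminf[symmetric] borel_measurable_times_ennreal borel_measurable_indicator) (use D in \<open>auto simp: measurable_lborel1\<close>)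
  also have "\<dots> = (\<integral>\<^sup>+x. ennreal (\<bar>det (J x)\<bar> * \<phi> (g x)) * indicator U x \<partial>lborel)"
  proof (rule nn_integral_cong)
    fix x
    have "(\<Sum>k. ennreal (\<bar>det (J x)\<bar> * \<phi> (g x)) * indicator (D k) x) =
        ennreal (\<bar>det (J x)\<bar> * \<phi> (g x)) * indicator (\<Union>k. D k) x"
      using suminf_indicator[OF disj, of x] by simp
    also have "\<dots> = ennreal (\<bar>det (J x)\<bar> * \<phi> (g x)) * indicator U x"
      unfolding UND by (auto simp: R_def indicator_def)
    finally show "(\<Sum>k. ennreal (\<bar>det (J x)\<bar> * \<phi> (g x)) * indicator (D k) x) =
      ennreal (\<bar>det (J x)\<bar> * \<phi> (g x)) * indicator U x" .
  qed
  finally show ?thesis .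
qed

text \<open>Renaming coordinates changes neither Lebesgue measure nor the determinant nor the number
  of preimages, so the formula is conjugated by the renamings \<open>S\<close> and
  \<open>T\<close>.\<close>

lemma area_formula:
  fixes g :: "real^'n \<Rightarrow> real^'n"
  assumes U: "open U"
    and der: "\<And>x. (g has_derivative (*v) (J x)) (at x)"
    and cont: "continuous_on UNIV J"
    and \<phi>: "integrable lborel \<phi>" "\<And>x. 0 \<le> \<phi> x"
    and meas: "(\<lambda>y. emeasure (count_space UNIV) {x\<in>U. g x = y}) \<in> borel_measurable borel"
  shows "(\<integral>\<^sup>+y. ennreal (\<phi> y) * emeasure (count_space UNIV) {x\<in>U. g x = y} \<partial>lborel) =
         (\<integral>\<^sup>+x. ennreal (\<bar>det (J x)\<bar> * \<phi> (g x)) * indicator U x \<partial>lborel)"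
proof -
  define S :: "real^'n wo_idx \<Rightarrow> real^'n" where "S x = (\<chi> i. x $ to_wo i)" for x
  define T :: "real^'n \<Rightarrow> real^'n wo_idx" where "T x = (\<chi> i. x $ of_wo i)" for x
  have ST[simp]: "S (T x) = x" and TS[simp]: "T (S y) = y" for x y
    by (simp_all add: S_def T_def vec_eq_iff to_wo_inverse of_wo_inverse)
  have bij_to: "bij (to_wo :: 'n \<Rightarrow> 'n wo_idx)"
    by (metis bijI' of_wo_inverse to_wo_inverse UNIV_I)
  have linS: "bounded_linear S" and linT: "bounded_linear T"
    unfolding S_def T_def by (auto intro!: bounded_linear_vec_nth bounded_linear_intros simp: linear_conv_bounded_linear[symmetric] linear_iff vec_eq_iff)
  have contS: "continuous_on A S" and contT: "continuous_on B T" for A B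
    using linS linT by (auto intro: linear_continuous_on)
  have dS: "distr lborel borel S = lborel" and dT: "distr lborel borel T = lborel"
    unfolding S_def T_def using lborel_distr_reindex[OF bij_to] lborel_distr_reindex[OF bij_of_wo] by auto
  have [measurable]: "S \<in> borel_measurable borel" "T \<in> borel_measurable borel"
    using contS contT by (auto intro: borel_measurable_continuous_onI)
  have [measurable]: "\<phi> \<in> borel_measurable borel" using \<phi>(1) by auto
  have "g \<in> borel_measurable borel"
    using der by (intro borel_measurable_continuous_onI)
      (meson continuous_at_imp_continuous_on has_derivative_continuous)
  note [measurable] = this
  have "continuous_on UNIV (\<lambda>x. det (J x))"
    unfolding det_def by (intro continuous_intros cont)
  then have [measurable]: "(\<lambda>x. det (J x)) \<in> borel_measurable borel"
    by (rule borel_measurable_continuous_onI)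
  define J' where "J' y = (\<chi> i j. J (S y) $ of_wo i $ of_wo j)" for y :: "real^'n wo_idx"
  have J'v: "J' y *v v = T (J (S y) *v S v)" for y v
    unfolding J'_def T_def S_def
    by (auto simp: vec_eq_iff matrix_vector_mult_def to_wo_inverse of_wo_inverse
       intro!: sum.reindex_bij_betw[OF bij_of_wo, of "\<lambda>j. J (\<chi> i. y $ to_wo i) $ of_wo _ $ j * v $ to_wo j", simplified of_wo_inverse])
  have der': "((\<lambda>y. T (g (S y))) has_derivative (*v) (J' y)) (at y)" for y
  proof -
    have "((\<lambda>y. T (g (S y))) has_derivative (\<lambda>v. T (J (S y) *v S v))) (at y)"
      by (intro has_derivative_compose[OF has_derivative_compose[OF bounded_linear_imp_has_derivative[OF linS] der]
        bounded_linear_imp_has_derivative[OF linT]])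
    also have "(\<lambda>v. T (J (S y) *v S v)) = (*v) (J' y)"
      by (rule ext) (simp add: J'v)
    finally show ?thesis .
  qed
  have cont': "continuous_on UNIV J'"
    unfolding J'_def
    by (intro continuous_intros continuous_on_compose2[OF cont contS]) auto
  have U': "open (S -` U)"
    using U contS by (auto intro: open_vimage)
  have [measurable]: "U \<in> sets borel" using U by auto
  have intS: "integrable lborel (\<lambda>y. \<phi> (S y))"
    using \<phi>(1) by (subst (asm) dS[symmetric]) (simp add: integrable_distr_eq)
  have countS: "emeasure (count_space UNIV) {x\<in>S -` U. T (g (S x)) = y} =
      emeasure (count_space UNIV) {x\<in>U. g x = S y}" for y
  proof -
    have "bij_betw S {x\<in>S -` U. T (g (S x)) = y} {x\<in>U. g x = S y}"
    proof (rule bij_betwI[where g=T])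
      show "S \<in> {x \<in> S -` U. T (g (S x)) = y} \<rightarrow> {x \<in> U. g x = S y}"
        by (auto intro: ST[symmetric])
    qed auto
    then show ?thesis
      using bij_betw_finite[of S] bij_betw_same_card[of S] by (simp add: emeasure_count_space)
  qed
  \<comment> \<open>Substitution along \<open>S\<close> is where \<open>meas\<close> enters: the
    integrand has to be Borel measurable.\<close>
  have "(\<integral>\<^sup>+y. ennreal (\<phi> y) * emeasure (count_space UNIV) {x\<in>U. g x = y} \<partial>lborel) =
      (\<integral>\<^sup>+y. ennreal (\<phi> (S y)) * emeasure (count_space UNIV) {x\<in>U. g x = S y} \<partial>lborel)"
    using meas by (subst dS[symmetric], subst nn_integral_distr) auto
  also have "\<dots> = (\<integral>\<^sup>+y. ennreal (\<phi> (S y)) * emeasure (count_space UNIV) {x\<in>S -` U. T (g (S x)) = y} \<partial>lborel)"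
    by (simp only: countS)
  also have "\<dots> = (\<integral>\<^sup>+x. ennreal (\<bar>det (J' x)\<bar> * \<phi> (S (T (g (S x))))) * indicator (S -` U) x \<partial>lborel)"
    by (rule area_formula_wellorder[OF U' der' cont' intS]) (simp add: \<phi>)
  also have "\<dots> = (\<integral>\<^sup>+x. ennreal (\<bar>det (J (S x))\<bar> * \<phi> (g (S x))) * indicator U (S x) \<partial>lborel)"
    unfolding J'_def by (simp add: det_reindex[OF bij_of_wo] indicator_def)
  also have "\<dots> = (\<integral>\<^sup>+x. ennreal (\<bar>det (J x)\<bar> * \<phi> (g x)) * indicator U x \<partial>lborel)"
    by (subst dS[symmetric], subst nn_integral_distr) auto
  finally show ?thesis .
qed

subsection \<open>Measurability of the number of zeros\<close>

text \<open>On a compact set the norm attains its infimum, so a zero exists as soon as arbitrarily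
  small values occur. By continuity small values are already detected on the countable dense part,
  which turns an uncountable existential into countably many measurable conditions.\<close>

lemma pred_compact_zero:
  fixes F :: "'w \<Rightarrow> 'a::euclidean_space \<Rightarrow> 'b::euclidean_space"
  assumes C: "compact C" "C \<subseteq> closure (C \<inter> D)" "countable D"
    and cont: "\<And>\<omega>. \<omega> \<in> space N \<Longrightarrow> continuous_on UNIV (F \<omega>)"
    and meas: "\<And>x. (\<lambda>\<omega>. F \<omega> x) \<in> borel_measurable N"
  shows "{\<omega> \<in> space N. \<exists>x\<in>C. F \<omega> x = 0} \<in> sets N"
proof -
  have eq: "(\<exists>x\<in>C. F \<omega> x = 0) \<longleftrightarrow> (\<forall>n. \<exists>d\<in>C \<inter> D. norm (F \<omega> d) < 1 / Suc n)"
    if \<omega>: "\<omega> \<in> space N" for \<omega>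
  proof
    assume "\<exists>x\<in>C. F \<omega> x = 0"
    then obtain x where x: "x \<in> C" "F \<omega> x = 0" by auto
    show "\<forall>n. \<exists>d\<in>C \<inter> D. norm (F \<omega> d) < 1 / Suc n"
    proof
      fix n
      have "isCont (F \<omega>) x" using cont[OF \<omega>] by (simp add: continuous_on_eq_continuous_at)
      then obtain e where e: "e > 0" "\<And>y. dist y x < e \<Longrightarrow> dist (F \<omega> y) (F \<omega> x) < 1 / Suc n"
        unfolding continuous_at_eps_delta by (metis of_nat_0_less_iff zero_less_Suc zero_less_divide_1_iff)
      obtain d where "d \<in> C \<inter> D" "dist d x < e"
        using x(1) C(2) e(1) by (meson closure_approachable subsetD)
      with e(2)[of d] x(2) show "\<exists>d\<in>C \<inter> D. norm (F \<omega> d) < 1 / Suc n" by auto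
    qed
  next
    assume *: "\<forall>n. \<exists>d\<in>C \<inter> D. norm (F \<omega> d) < 1 / Suc n"
    then have "C \<noteq> {}" by auto
    moreover have "continuous_on C (\<lambda>x. norm (F \<omega> x))"
      using continuous_on_subset[OF cont[OF \<omega>]] by (intro continuous_intros) auto
    ultimately obtain x where x: "x \<in> C" "\<And>y. y \<in> C \<Longrightarrow> norm (F \<omega> x) \<le> norm (F \<omega> y)"
      using continuous_attains_inf[OF C(1)] by metis
    have "\<not> norm (F \<omega> x) > 0"
    proof
      assume "norm (F \<omega> x) > 0"
      then obtain n where "1 / Suc n < norm (F \<omega> x)" using nat_approx_posE by metis
      with * x(2) show False by (meson IntD1 less_le_trans less_asym)
    qed
    with x(1) show "\<exists>x\<in>C. F \<omega> x = 0" by auto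
  qed
  have "{\<omega> \<in> space N. \<exists>x\<in>C. F \<omega> x = 0} = {\<omega> \<in> space N. \<forall>n. \<exists>d\<in>C \<inter> D. norm (F \<omega> d) < 1 / Suc n}"
    using eq by blast
  also have "\<dots> \<in> sets N"
  proof -
    have "countable (C \<inter> D)" using C(3) by blast
    then show ?thesis using meas by measurable
  qed
  finally show ?thesis .
qed

text \<open>
  The count is the supremum, over the countably many finite disjoint families of closed balls from
  a countable base, of the number of members that contain a zero.
\<close>

lemma measurable_zero_count:
  fixes F :: "'w \<Rightarrow> 'a::euclidean_space \<Rightarrow> 'b::euclidean_space"
  assumes U: "open U"
    and cont: "\<And>\<omega>. \<omega> \<in> space N \<Longrightarrow> continuous_on UNIV (F \<omega>)"
    and meas: "\<And>x. (\<lambda>\<omega>. F \<omega> x) \<in> borel_measurable N"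
  shows "(\<lambda>\<omega>. emeasure (count_space UNIV) {x\<in>U. F \<omega> x = 0}) \<in> borel_measurable N"
proof -
  obtain D :: "'a set" where D: "countable D" "\<And>X. open X \<Longrightarrow> X \<noteq> {} \<Longrightarrow> \<exists>d\<in>D. d \<in> X"
    using countable_dense_setE by metis
  define \<C> where "\<C> = {C. C \<subseteq> U \<and> C \<in> (\<lambda>(d, n). cball d (1 / real (Suc n))) ` (D \<times> UNIV)}"
  have "countable \<C>"
  proof (rule countable_subset)
    show "countable ((\<lambda>(d, n). cball d (1 / real (Suc n))) ` (D \<times> (UNIV :: nat set)))"
      using D(1) by (intro countable_image countable_SIGMA) auto
  qed (auto simp: \<C>_def)
  define \<K> where "\<K> = {K. finite K \<and> K \<subseteq> \<C> \<and> disjoint K}"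
  have cK: "countable \<K>"
    unfolding \<K>_def by (rule countable_subset[OF _ countable_Collect_finite_subset[OF \<open>countable \<C>\<close>]]) auto
  let ?Z = "\<lambda>C \<omega>. \<exists>x\<in>C. F \<omega> x = 0"
  let ?N = "\<lambda>\<omega>. emeasure (count_space UNIV) {x\<in>U. F \<omega> x = 0}"
  \<comment> \<open>One zero is selected from each member of \<open>K\<close> that has one;
    disjointness makes the selected zeros distinct.\<close>
  have lower: "(\<Sum>C\<in>K. of_bool (?Z C \<omega>)) \<le> ?N \<omega>" if K: "K \<in> \<K>" for K \<omega>
  proof -
    define z where "z C = (SOME x. x \<in> C \<and> F \<omega> x = 0)" for C
    let ?K = "{C\<in>K. ?Z C \<omega>}"
    have z: "z C \<in> C \<and> F \<omega> (z C) = 0" if "C \<in> ?K" for C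
      unfolding z_def by (rule someI_ex) (use that in auto)
    have fin: "finite K" and disj: "disjoint K" and sub: "\<And>C. C \<in> K \<Longrightarrow> C \<subseteq> U"
      using K by (auto simp: \<K>_def \<C>_def)
    have "inj_on z ?K"
    proof (rule inj_onI)
      fix C C' assume *: "C \<in> ?K" "C' \<in> ?K" "z C = z C'"
      then have "z C \<in> C \<inter> C'" using z[of C] z[of C'] by auto
      with * disj show "C = C'" by (auto simp: disjoint_def)
    qed
    moreover have sub': "z ` ?K \<subseteq> {x\<in>U. F \<omega> x = 0}" using z sub by blast
    ultimately have "of_nat (card ?K) = emeasure (count_space UNIV) (z ` ?K)"
      using fin by (simp add: card_image)
    also have "\<dots> \<le> ?N \<omega>" using sub' by (intro emeasure_mono) auto
    finally show ?thesis using fin by (simp add: sum.If_cases of_bool_def Int_def)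
  qed
  have upper: "of_nat (card Y) \<le> (SUP K\<in>\<K>. \<Sum>C\<in>K. of_bool (?Z C \<omega>) :: ennreal)"
    if Y: "finite Y" "Y \<subseteq> {x\<in>U. F \<omega> x = 0}" for Y \<omega>
  proof -
    obtain e where e: "e > 0" "\<And>x. x \<in> Y \<Longrightarrow> ball x e \<subseteq> U"
    proof -
      have "\<exists>e>0. \<forall>x\<in>Y. ball x e \<subseteq> U" using Y
      proof (induction Y rule: finite_induct)
        case empty show ?case by (auto intro: exI[of _ 1])
      next
        case (insert x Y)
        then obtain e where e: "e > 0" "\<forall>x\<in>Y. ball x e \<subseteq> U" by auto
        from insert.prems U obtain e' where "e' > 0" "ball x e' \<subseteq> U"
          by (auto simp: open_contains_ball)
        with e show ?case by (intro exI[of _ "min e e'"]) (auto simp: ball_min_Int)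
      qed
      then show ?thesis using that by blast
    qed
    obtain s where s: "s > 0" "\<And>x y. x \<in> Y \<Longrightarrow> y \<in> Y \<Longrightarrow> x \<noteq> y \<Longrightarrow> s \<le> dist x y"
    proof -
      have "\<exists>s>0. \<forall>x\<in>Y. \<forall>y\<in>Y. x \<noteq> y \<longrightarrow> s \<le> dist x y"
      proof (cases "\<exists>x\<in>Y. \<exists>y\<in>Y. x \<noteq> y")
        case True
        let ?S = "(\<lambda>(x, y). dist x y) ` {p\<in>Y \<times> Y. fst p \<noteq> snd p}"
        have fin: "finite ?S" and ne: "?S \<noteq> {}" using Y(1) True by auto
        have "Min ?S \<in> ?S" using fin ne by (rule Min_in)
        then have "Min ?S > 0" by auto
        moreover have "\<forall>x\<in>Y. \<forall>y\<in>Y. x \<noteq> y \<longrightarrow> Min ?S \<le> dist x y"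
          using fin by (auto intro!: Min_le)
        ultimately show ?thesis by blast
      next
        case False
        then show ?thesis by (auto intro: exI[of _ 1])
      qed
      then show ?thesis using that by blast
    qed
    \<comment> \<open>The ball assigned to a zero \<open>x\<close> has radius \<open>r\<close> and a
      centre within \<open>r\<close> of \<open>x\<close>, so it stays within \<open>2 * r\<close> of
      \<open>x\<close>. Hence \<open>4 * r < s\<close> separates the balls of different zeros, and
      \<open>4 * r < e\<close> keeps them inside \<open>U\<close>.\<close>
    have "min e s / 4 > 0" using e(1) s(1) by simp
    then obtain n where n: "1 / real (Suc n) < min e s / 4" using nat_approx_posE by metis
    define r where "r = 1 / real (Suc n)"
    have r: "r > 0" "4 * r < e" "4 * r < s" using n by (auto simp: r_def)
    have "\<forall>x. \<exists>d\<in>D. d \<in> ball x r"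
      using D(2)[of "ball _ r"] r(1) by simp
    then obtain d where d: "\<And>x. d x \<in> D" "\<And>x. dist x (d x) < r"
      by (metis mem_ball)
    define c where "c x = cball (d x) r" for x
    have xc: "x \<in> c x" for x using d(2)[of x] by (simp add: c_def dist_commute)
    have close: "dist x y < 2 * r" if "y \<in> c x" for x y
      using that d(2)[of x] dist_triangle[of x y "d x"] by (simp add: c_def)
    have cU: "c x \<subseteq> U" if "x \<in> Y" for x
      using close[of _ x] r e(2)[OF that] by fastforce
    have dj: "c x \<inter> c y = {}" if "x \<in> Y" "y \<in> Y" "x \<noteq> y" for x y
    proof (rule ccontr)
      assume "c x \<inter> c y \<noteq> {}"
      then obtain w where "w \<in> c x" "w \<in> c y" by auto
      then have "dist x w < 2 * r" "dist y w < 2 * r" using close by auto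
      then have "dist x y < 4 * r" using dist_triangle2[of x y w] by simp
      with s(2)[OF that] r show False by simp
    qed
    have inj: "inj_on c Y" using dj xc by (metis disjoint_iff inj_onI)
    have "c x \<in> \<C>" if "x \<in> Y" for x
      unfolding \<C>_def using cU[OF that] d(1)[of x]
      by (auto simp: c_def r_def intro!: image_eqI[of _ _ "(d x, n)"])
    moreover have "disjoint (c ` Y)"
    proof (rule disjointI)
      fix a b assume "a \<in> c ` Y" "b \<in> c ` Y" "a \<noteq> b"
      then show "a \<inter> b = {}" using dj by (metis imageE)
    qed
    ultimately have "c ` Y \<in> \<K>"
      using Y(1) by (auto simp: \<K>_def)
    moreover have "(\<Sum>C\<in>c ` Y. of_bool (?Z C \<omega>) :: ennreal) = of_nat (card Y)"
    proof -
      have "(\<Sum>C\<in>c ` Y. of_bool (?Z C \<omega>) :: ennreal) = (\<Sum>x\<in>Y. of_bool (?Z (c x) \<omega>))"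
        using inj by (rule sum.reindex[unfolded o_def])
      also have "\<dots> = (\<Sum>x\<in>Y. 1)"
        using xc Y(2) by (intro sum.cong) (auto simp: of_bool_def)
      finally show ?thesis by simp
    qed
    moreover have "(\<Sum>C\<in>c ` Y. of_bool (?Z C \<omega>) :: ennreal) \<le> (SUP K\<in>\<K>. \<Sum>C\<in>K. of_bool (?Z C \<omega>))"
      if "c ` Y \<in> \<K>" using that by (rule SUP_upper)
    ultimately show ?thesis by simp
  qed
  have eq: "?N \<omega> = (SUP K\<in>\<K>. \<Sum>C\<in>K. of_bool (?Z C \<omega>))" for \<omega>
  proof (rule antisym)
    show "(SUP K\<in>\<K>. \<Sum>C\<in>K. of_bool (?Z C \<omega>)) \<le> ?N \<omega>" using lower by (rule SUP_least)
    show "?N \<omega> \<le> (SUP K\<in>\<K>. \<Sum>C\<in>K. of_bool (?Z C \<omega>))"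
    proof (cases "finite {x\<in>U. F \<omega> x = 0}")
      case True
      then show ?thesis using upper[of "{x\<in>U. F \<omega> x = 0}" \<omega>] by simp
    next
      case False
      have "of_nat n \<le> (SUP K\<in>\<K>. \<Sum>C\<in>K. of_bool (?Z C \<omega>) :: ennreal)" for n
      proof -
        obtain Y where "finite Y" "card Y = n" "Y \<subseteq> {x\<in>U. F \<omega> x = 0}"
          using infinite_arbitrarily_large[OF False, of n] by auto
        then show ?thesis using upper[of Y \<omega>] by simp
      qed
      then have "(SUP n. of_nat n :: ennreal) \<le> (SUP K\<in>\<K>. \<Sum>C\<in>K. of_bool (?Z C \<omega>))"
        by (rule SUP_least)
      then have "(SUP K\<in>\<K>. \<Sum>C\<in>K. of_bool (?Z C \<omega>)) = (top :: ennreal)"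
        by (simp only: ennreal_SUP_of_nat_eq_top top_unique)
      then show ?thesis by (simp only: top_greatest)
    qed
  qed
  have pm: "{\<omega> \<in> space N. ?Z C \<omega>} \<in> sets N" if "C \<in> \<C>" for C
  proof (rule pred_compact_zero[OF _ _ D(1) cont meas])
    from that obtain d n where C: "C = cball d (1 / real (Suc n))" by (auto simp: \<C>_def)
    show "compact C" by (simp add: C)
    \<comment> \<open>Density of \<open>D\<close> in the whole space does not restrict to arbitrary
      closed sets. It does restrict to a closed ball of positive radius, since this is the closure
      of the open ball \<open>?B\<close> and \<open>D\<close> meets every non-empty open part of
      \<open>?B\<close>.\<close>
    let ?B = "ball d (1 / real (Suc n))"
    show "C \<subseteq> closure (C \<inter> D)"
    proof
      fix x assume "x \<in> C"
      then have x: "x \<in> closure ?B" by (simp add: C)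
      show "x \<in> closure (C \<inter> D)"
        unfolding closure_approachable
      proof (intro allI impI)
        fix e :: real assume "e > 0"
        with x have "\<exists>b\<in>?B. dist b x < e" unfolding closure_approachable by blast
        then obtain b where "b \<in> ?B" "dist b x < e" ..
        then have "b \<in> ?B \<inter> ball x e" by (simp add: dist_commute)
        then obtain y where y: "y \<in> D" "y \<in> ?B \<inter> ball x e"
          using D(2)[of "?B \<inter> ball x e"] by (metis empty_iff open_Int open_ball)
        then have "y \<in> C" by (simp add: C)
        with y show "\<exists>y\<in>C \<inter> D. dist y x < e" by (intro bexI[of _ y]) (auto simp: dist_commute)
      qed
    qed
  qed
  have "(\<lambda>\<omega>. \<Sum>C\<in>K. of_bool (?Z C \<omega>) :: ennreal) \<in> borel_measurable N" if "K \<in> \<K>" for K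
  proof (rule borel_measurable_sum)
    fix C assume "C \<in> K"
    then have "C \<in> \<C>" using that by (auto simp: \<K>_def)
    from pm[OF this] have "Measurable.pred N (\<lambda>\<omega>. ?Z C \<omega>)" by (simp add: pred_def)
    then show "(\<lambda>\<omega>. of_bool (?Z C \<omega>) :: ennreal) \<in> borel_measurable N"
      unfolding of_bool_def by measurable
  qed
  then show ?thesis unfolding eq using cK by (rule borel_measurable_SUP[rotated])
qed

subsection \<open>Standard Gaussian vectors\<close>

definition gauss_density :: "'a::euclidean_space \<Rightarrow> real" where
  "gauss_density y = (1 / sqrt (2 * pi)) ^ DIM('a) * exp (- (norm y)\<^sup>2 / 2)"

definition std_gauss :: "'a::euclidean_space measure" where
  "std_gauss = density lborel (\<lambda>y. ennreal (gauss_density y))"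

lemma gauss_density_pos: "0 < gauss_density y"
  by (simp add: gauss_density_def)

lemma gauss_density_nonneg [simp]: "0 \<le> gauss_density y"
  using gauss_density_pos[of y] by simp

lemma borel_measurable_gauss_density [measurable]: "gauss_density \<in> borel_measurable borel"
  unfolding gauss_density_def[abs_def] by measurable

lemma sets_std_gauss [simp, measurable_cong]: "sets std_gauss = sets borel"
  by (simp add: std_gauss_def)

lemma space_std_gauss [simp]: "space std_gauss = UNIV"
  by (simp add: std_gauss_def)

lemma gauss_density_prod:
  "gauss_density y = (\<Prod>b\<in>Basis. std_normal_density (y \<bullet> b))"
proof -
  have "(norm y)\<^sup>2 = (\<Sum>b\<in>Basis. (y \<bullet> b)\<^sup>2)"
    unfolding power2_norm_eq_inner euclidean_inner[of y y] by (simp only: power2_eq_square)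
  then have "exp (- (norm y)\<^sup>2 / 2) = (\<Prod>b\<in>Basis. exp (- (y \<bullet> b)\<^sup>2 / 2))"
    by (subst exp_sum[symmetric]) (auto simp: sum_negf sum_divide_distrib)
  then show ?thesis
    unfolding gauss_density_def std_normal_density_def
    by (simp only: prod.distrib prod_constant)
qed

lemma nn_integral_std_gauss:
  "f \<in> borel_measurable borel \<Longrightarrow>
    (\<integral>\<^sup>+y. f y \<partial>std_gauss) = (\<integral>\<^sup>+y. ennreal (gauss_density y) * f y \<partial>lborel)"
  unfolding std_gauss_def by (subst nn_integral_density) auto

lemma nn_integral_std_gauss_prod:
  fixes f :: "'a::euclidean_space \<Rightarrow> real \<Rightarrow> ennreal"
  assumes [measurable]: "\<And>b. b \<in> Basis \<Longrightarrow> f b \<in> borel_measurable borel"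
  shows "(\<integral>\<^sup>+y. (\<Prod>b\<in>Basis. f b (y \<bullet> b)) \<partial>std_gauss) =
         (\<Prod>b\<in>Basis. \<integral>\<^sup>+t. ennreal (std_normal_density t) * f b t \<partial>lborel)"
proof -
  have "(\<integral>\<^sup>+y. (\<Prod>b\<in>Basis. f b (y \<bullet> b)) \<partial>std_gauss) =
      (\<integral>\<^sup>+y. (\<Prod>b\<in>Basis. ennreal (std_normal_density (y \<bullet> b)) * f b (y \<bullet> b)) \<partial>lborel)"
    by (subst nn_integral_std_gauss)
       (auto simp: gauss_density_prod prod_ennreal[symmetric] prod.distrib)
  also have "\<dots> = (\<Prod>b\<in>Basis. \<integral>\<^sup>+t. ennreal (std_normal_density t) * f b t \<partial>lborel)"
    by (rule nn_integral_lborel_prod) auto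
  finally show ?thesis .
qed

lemma nn_integral_std_normal_density: "(\<integral>\<^sup>+t. ennreal (std_normal_density t) \<partial>lborel) = 1"
  using prob_space.emeasure_space_1[OF prob_space_normal_density[of 1 0]]
  by (simp add: emeasure_density)

lemma prob_space_std_gauss: "prob_space (std_gauss :: 'a::euclidean_space measure)"
proof
  show "emeasure (std_gauss :: 'a measure) (space std_gauss) = 1"
    using nn_integral_std_gauss_prod[of "\<lambda>_::'a. \<lambda>_. 1"]
    by (simp add: nn_integral_std_normal_density)
qed

section \<open>Products of standard Gaussian measures\<close>

lemma product_sigma_finite_std_gauss:
  "product_sigma_finite (\<lambda>_. std_gauss :: 'a::euclidean_space measure)"
proof -
  interpret prob_space "std_gauss :: 'a measure" by (rule prob_space_std_gauss)
  show ?thesis unfolding product_sigma_finite_def by (intro allI sigma_finite_measure_axioms)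
qed

lemma product_sigma_finite_lborel:
  "product_sigma_finite (\<lambda>_. lborel :: 'a::euclidean_space measure)"
  by (simp add: product_sigma_finite_def sigma_finite_lborel)

lemma sets_PiM_std_gauss [measurable_cong]:
  "sets (PiM B (\<lambda>_. std_gauss)) = sets (PiM B (\<lambda>_. borel))"
  by (rule sets_PiM_cong) auto

lemma sets_PiM_lborel [measurable_cong]:
  "sets (PiM B (\<lambda>_. lborel)) = sets (PiM B (\<lambda>_. borel))"
  by (rule sets_PiM_cong) auto

lemma nn_integral_gauss_density: "(\<integral>\<^sup>+y. ennreal (gauss_density (y::'a::euclidean_space)) \<partial>lborel) = 1"
  using prob_space.emeasure_space_1[OF prob_space_std_gauss[where 'a='a]]
  by (simp add: std_gauss_def emeasure_density)

lemma integrable_gauss_density: "integrable lborel (gauss_density :: 'a::euclidean_space \<Rightarrow> real)"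
  by (rule integrableI_nonneg) (auto simp: nn_integral_gauss_density)

text \<open>Gaussian products are not translation invariant. Writing them as a weight times a
  product of Lebesgue measures makes translations of all coordinates available, with the effect on
  the weight computed by hand.\<close>

lemma PiM_std_gauss_eq_density:
  assumes "finite B"
  shows "PiM B (\<lambda>_. std_gauss :: 'a::euclidean_space measure) =
    density (PiM B (\<lambda>_. lborel)) (\<lambda>\<omega>. \<Prod>a\<in>B. ennreal (gauss_density (\<omega> a)))"
proof -
  interpret L: product_sigma_finite "\<lambda>_. lborel :: 'a measure" by (rule product_sigma_finite_lborel)
  interpret G: product_sigma_finite "\<lambda>_. std_gauss :: 'a measure" by (rule product_sigma_finite_std_gauss)
  have "density (PiM B (\<lambda>_. lborel)) (\<lambda>\<omega>. \<Prod>a\<in>B. ennreal (gauss_density (\<omega> a :: 'a))) = PiM B (\<lambda>_. std_gauss)"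
  proof (rule G.PiM_eqI[OF assms])
    fix X :: "'b \<Rightarrow> 'a set" assume X: "\<And>i. i \<in> B \<Longrightarrow> X i \<in> sets std_gauss"
    have PX: "Pi\<^sub>E B X \<in> sets (PiM B (\<lambda>_. lborel))"
      using X assms by (intro sets_PiM_I_finite) auto
    have "emeasure (density (PiM B (\<lambda>_. lborel)) (\<lambda>\<omega>. \<Prod>a\<in>B. ennreal (gauss_density (\<omega> a)))) (Pi\<^sub>E B X) =
        (\<integral>\<^sup>+\<omega>. (\<Prod>a\<in>B. ennreal (gauss_density (\<omega> a))) * indicator (Pi\<^sub>E B X) \<omega> \<partial>PiM B (\<lambda>_. lborel))"
      using PX by (subst emeasure_density) auto
    also have "\<dots> = (\<integral>\<^sup>+\<omega>. (\<Prod>a\<in>B. ennreal (gauss_density (\<omega> a)) * indicator (X a) (\<omega> a)) \<partial>PiM B (\<lambda>_. lborel))"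
    proof (rule nn_integral_cong)
      fix \<omega> :: "'b \<Rightarrow> 'a" assume "\<omega> \<in> space (PiM B (\<lambda>_. lborel))"
      then have ext: "\<omega> \<in> extensional B" by (auto simp: space_PiM PiE_def)
      have "indicator (Pi\<^sub>E B X) \<omega> = (\<Prod>a\<in>B. indicator (X a) (\<omega> a) :: ennreal)"
      proof (cases "\<omega> \<in> Pi\<^sub>E B X")
        case True
        then show ?thesis by (auto simp: PiE_iff)
      next
        case False
        with ext obtain a where "a \<in> B" "\<omega> a \<notin> X a" by (auto simp: PiE_iff)
        with False show ?thesis using assms by (auto simp: indicator_def prod_zero_iff)
      qed
      then show "(\<Prod>a\<in>B. ennreal (gauss_density (\<omega> a))) * indicator (Pi\<^sub>E B X) \<omega> =
          (\<Prod>a\<in>B. ennreal (gauss_density (\<omega> a)) * indicator (X a) (\<omega> a))"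
        by (simp add: prod.distrib)
    qed
    also have "\<dots> = (\<Prod>a\<in>B. \<integral>\<^sup>+y. ennreal (gauss_density y) * indicator (X a) y \<partial>lborel)"
      using X assms by (intro L.product_nn_integral_prod) auto
    also have "\<dots> = (\<Prod>a\<in>B. emeasure std_gauss (X a))"
      using X by (intro prod.cong) (auto simp: std_gauss_def emeasure_density)
    finally show "emeasure (density (PiM B (\<lambda>_. lborel)) (\<lambda>\<omega>. \<Prod>a\<in>B. ennreal (gauss_density (\<omega> a)))) (Pi\<^sub>E B X) =
       (\<Prod>i\<in>B. emeasure std_gauss (X i))" .
  qed (simp add: sets_PiM_std_gauss sets_PiM_lborel)
  then show ?thesis by simp
qed

lemma nn_integral_PiM_std_gauss:
  fixes f :: "('b \<Rightarrow> 'a::euclidean_space) \<Rightarrow> ennreal"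
  assumes "finite B" and [measurable]: "f \<in> borel_measurable (PiM B (\<lambda>_. borel))"
  shows "(\<integral>\<^sup>+\<omega>. f \<omega> \<partial>PiM B (\<lambda>_. std_gauss)) =
    (\<integral>\<^sup>+\<omega>. (\<Prod>a\<in>B. ennreal (gauss_density (\<omega> a))) * f \<omega> \<partial>PiM B (\<lambda>_. lborel))"
  unfolding PiM_std_gauss_eq_density[OF assms(1)]
  by (subst nn_integral_density) auto

lemma nn_integral_PiM_lborel_translate:
  fixes f :: "('b \<Rightarrow> 'a::euclidean_space) \<Rightarrow> ennreal"
  assumes "finite B" and [measurable]: "f \<in> borel_measurable (PiM B (\<lambda>_. borel))"
  shows "(\<integral>\<^sup>+\<omega>. f (\<lambda>a\<in>B. \<omega> a + c a) \<partial>PiM B (\<lambda>_. lborel)) = (\<integral>\<^sup>+\<omega>. f \<omega> \<partial>PiM B (\<lambda>_. lborel))"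
proof -
  interpret L: product_sigma_finite "\<lambda>_. lborel :: 'a measure" by (rule product_sigma_finite_lborel)
  have [measurable]: "(\<lambda>\<omega>. \<lambda>a\<in>B. \<omega> a + c a) \<in> measurable (PiM B (\<lambda>_. lborel)) (PiM B (\<lambda>_. lborel :: 'a measure))"
    by (intro measurable_restrict) measurable
  have "distr (PiM B (\<lambda>_. lborel)) (PiM B (\<lambda>_. lborel)) (\<lambda>\<omega>. \<lambda>a\<in>B. \<omega> a + c a) = PiM B (\<lambda>_. lborel :: 'a measure)"
  proof (rule L.PiM_eqI[OF assms(1)])
    fix X :: "'b \<Rightarrow> 'a set" assume X: "\<And>i. i \<in> B \<Longrightarrow> X i \<in> sets lborel"
    have PX: "Pi\<^sub>E B X \<in> sets (PiM B (\<lambda>_. lborel))"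
      using X assms by (intro sets_PiM_I_finite) auto
    have vim: "(\<lambda>\<omega>. \<lambda>a\<in>B. \<omega> a + c a) -` Pi\<^sub>E B X \<inter> space (PiM B (\<lambda>_. lborel)) =
       (\<Pi>\<^sub>E a\<in>B. (\<lambda>y. c a + y) -` X a)"
      by (auto simp: space_PiM PiE_iff add.commute)
    have X': "(\<lambda>y. c a + y) -` X a \<in> sets lborel" if "a \<in> B" for a
      using measurable_sets[of "\<lambda>y. c a + y" borel borel "X a"] X[OF that] by simp
    have "emeasure (distr (PiM B (\<lambda>_. lborel)) (PiM B (\<lambda>_. lborel)) (\<lambda>\<omega>. \<lambda>a\<in>B. \<omega> a + c a)) (Pi\<^sub>E B X) =
      emeasure (PiM B (\<lambda>_. lborel)) (\<Pi>\<^sub>E a\<in>B. (\<lambda>y. c a + y) -` X a)"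
      using PX by (subst emeasure_distr) (auto simp: vim)
    also have "\<dots> = (\<Prod>a\<in>B. emeasure lborel ((\<lambda>y. c a + y) -` X a))"
      using X' by (intro L.emeasure_PiM assms(1)) auto
    also have "\<dots> = (\<Prod>a\<in>B. emeasure lborel (X a))"
    proof (rule prod.cong[OF refl])
      fix a assume "a \<in> B"
      have "emeasure lborel (X a) = emeasure (distr lborel borel ((+) (c a))) (X a)"
        by (simp add: lborel_distr_plus)
      also have "\<dots> = emeasure lborel ((\<lambda>y. c a + y) -` X a)"
        using X[OF \<open>a \<in> B\<close>] by (subst emeasure_distr) auto
      finally show "emeasure lborel ((\<lambda>y. c a + y) -` X a) = emeasure lborel (X a)" by simp
    qed
    finally show "emeasure (distr (PiM B (\<lambda>_. lborel)) (PiM B (\<lambda>_. lborel)) (\<lambda>\<omega>. \<lambda>a\<in>B. \<omega> a + c a)) (Pi\<^sub>E B X) =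
      (\<Prod>a\<in>B. emeasure lborel (X a))" .
  qed simp
  then have "(\<integral>\<^sup>+\<omega>. f \<omega> \<partial>PiM B (\<lambda>_. lborel)) =
     (\<integral>\<^sup>+\<omega>. f \<omega> \<partial>distr (PiM B (\<lambda>_. lborel)) (PiM B (\<lambda>_. lborel)) (\<lambda>\<omega>. \<lambda>a\<in>B. \<omega> a + c a))"
    by simp
  also have "\<dots> = (\<integral>\<^sup>+\<omega>. f (\<lambda>a\<in>B. \<omega> a + c a) \<partial>PiM B (\<lambda>_. lborel))"
    by (subst nn_integral_distr) auto
  finally show ?thesis by simp
qed

section \<open>Gaussian integrals of functions invariant along one direction\<close>

lemma nn_integral_lborel_affine:
  fixes f :: "'a::euclidean_space \<Rightarrow> ennreal"
  assumes [measurable]: "f \<in> borel_measurable borel" and "c \<noteq> 0"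
  shows "(\<integral>\<^sup>+x. f x \<partial>lborel) = ennreal (\<bar>c\<bar> ^ DIM('a)) * (\<integral>\<^sup>+x. f (t + c *\<^sub>R x) \<partial>lborel)"
  by (subst lborel_affine[OF assms(2), of t])
     (simp add: nn_integral_density nn_integral_distr nn_integral_cmult)

lemma nn_integral_exp_norm_sq:
  fixes K :: real
  assumes K: "K > 0"
  shows "(\<integral>\<^sup>+t. ennreal (exp (- K * (norm (t::'a::euclidean_space))\<^sup>2 / 2)) \<partial>lborel) = ennreal (sqrt (2 * pi / K) ^ DIM('a))"
proof -
  have eq: "exp (- K * (norm ((1 / sqrt K) *\<^sub>R t))\<^sup>2 / 2) = sqrt (2 * pi) ^ DIM('a) * gauss_density t" for t :: 'a
    using K by (simp add: gauss_density_def power_mult_distrib power_divide)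
  have "(\<integral>\<^sup>+t. ennreal (exp (- K * (norm (t::'a))\<^sup>2 / 2)) \<partial>lborel) =
      ennreal (\<bar>1 / sqrt K\<bar> ^ DIM('a)) * (\<integral>\<^sup>+t. ennreal (exp (- K * (norm (0 + (1 / sqrt K) *\<^sub>R (t::'a)))\<^sup>2 / 2)) \<partial>lborel)"
    using K by (intro nn_integral_lborel_affine) auto
  also have "\<dots> = ennreal (\<bar>1 / sqrt K\<bar> ^ DIM('a)) * (\<integral>\<^sup>+t. ennreal (sqrt (2 * pi) ^ DIM('a)) * ennreal (gauss_density (t::'a)) \<partial>lborel)"
    unfolding add_0 eq by (simp add: ennreal_mult)
  also have "\<dots> = ennreal (\<bar>1 / sqrt K\<bar> ^ DIM('a)) * ennreal (sqrt (2 * pi) ^ DIM('a))"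
    by (subst nn_integral_cmult) (auto simp: nn_integral_gauss_density)
  also have "\<dots> = ennreal (sqrt (2 * pi / K) ^ DIM('a))"
    using K by (subst ennreal_mult[symmetric]) (auto simp: real_sqrt_divide power_divide)
  finally show ?thesis .
qed

text \<open>
  Write \<open>w = h + v \<otimes> t\<close> with \<open>h\<close> in the subspace \<open>\<Sum> v\<^sub>a h\<^sub>a = 0\<close>, parametrised by its components
  other than \<open>b\<close>. The cross terms of the Gaussian exponents cancel and \<open>g\<close> does not depend on \<open>t\<close>,
  so the \<open>t\<close>-integral splits off.
\<close>

lemma std_gauss_disintegration:
  fixes g :: "('b \<Rightarrow> 'a::euclidean_space) \<Rightarrow> ennreal" and v :: "'b \<Rightarrow> real"
  assumes A: "finite A" "b \<in> A" and vb: "v b > 0"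
    and g[measurable]: "g \<in> borel_measurable (PiM A (\<lambda>_. borel))"
    and inv: "\<And>w t. w \<in> extensional A \<Longrightarrow> g (\<lambda>a\<in>A. w a + v a *\<^sub>R t) = g w"
  defines "K \<equiv> (\<Sum>a\<in>A. (v a)\<^sup>2)"
  defines "s \<equiv> (\<lambda>w. - ((1 / v b) *\<^sub>R (\<Sum>a\<in>A - {b}. v a *\<^sub>R w a)))"
  shows "(\<integral>\<^sup>+w. g w \<partial>PiM A (\<lambda>_. std_gauss)) =
    ennreal ((sqrt (2 * pi * K) / v b) ^ DIM('a)) *
    (\<integral>\<^sup>+w. ennreal (gauss_density (s w)) * g (w(b := s w)) \<partial>PiM (A - {b}) (\<lambda>_. std_gauss))"
proof -
  interpret G: product_sigma_finite "\<lambda>_. std_gauss :: 'a measure" by (rule product_sigma_finite_std_gauss)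
  interpret L: product_sigma_finite "\<lambda>_. lborel :: 'a measure" by (rule product_sigma_finite_lborel)
  define B where "B = A - {b}"
  have B: "finite B" "b \<notin> B" "insert b B = A" using A by (auto simp: B_def)
  interpret LB: sigma_finite_measure "PiM B (\<lambda>_. lborel :: 'a measure)" by (rule L.sigma_finite[OF B(1)])
  interpret P: pair_sigma_finite "PiM B (\<lambda>_. lborel :: 'a measure)" "lborel :: 'a measure" ..
  have s_def': "s w = - ((1 / v b) *\<^sub>R (\<Sum>a\<in>B. v a *\<^sub>R w a))" for w
    by (simp add: s_def B_def)
  have KB: "K = (\<Sum>a\<in>B. (v a)\<^sup>2) + (v b)\<^sup>2"
    unfolding K_def B(3)[symmetric] using B(1,2) by simp
  have K: "K > 0" unfolding KB using vb by (intro add_nonneg_pos sum_nonneg) auto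
  \<comment> \<open>Translating every \<open>w a\<close> with \<open>a \<in> B\<close> by
    \<open>v a *\<^sub>R t\<close> lowers \<open>s w\<close> by
    \<open>((\<Sum>a\<in>B. (v a)\<^sup>2) / v b) *\<^sub>R t\<close>. The scale \<open>c\<close> is
    chosen to compensate for this: after the translation \<open>s w + c *\<^sub>R t\<close> has
    become \<open>s w + v b *\<^sub>R t\<close>, so the coordinate \<open>b\<close> too is displaced
    by its own multiple of \<open>t\<close>.\<close>
  define c where "c = K / v b"
  have c: "c > 0" using K vb by (simp add: c_def)
  let ?m = "DIM('a)"
  have [measurable]: "s \<in> borel_measurable (PiM B (\<lambda>_. borel))"
    unfolding s_def'[abs_def] by measurable
  have [measurable]: "(\<lambda>x. (f x)(b := h x)) \<in> measurable N (PiM A (\<lambda>_. borel))"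
    if "f \<in> measurable N (PiM B (\<lambda>_. borel))" "h \<in> borel_measurable N"
    for f :: "'x \<Rightarrow> 'b \<Rightarrow> 'a" and h and N :: "'x measure"
    using measurable_fun_upd[of A B b f N "\<lambda>_. borel" h] B that by auto
  define P where "P w = (\<Prod>a\<in>B. ennreal (gauss_density (w a)))" for w :: "'b \<Rightarrow> 'a"
  have [measurable]: "P \<in> borel_measurable (PiM B (\<lambda>_. borel))"
    unfolding P_def[abs_def] by measurable
  define I where "I = (\<integral>\<^sup>+w. ennreal (gauss_density (s w)) * g (w(b := s w)) \<partial>PiM B (\<lambda>_. std_gauss))"
  have I_eq: "I = (\<integral>\<^sup>+w. P w * (ennreal (gauss_density (s w)) * g (w(b := s w))) \<partial>PiM B (\<lambda>_. lborel))"
    unfolding I_def P_def by (rule nn_integral_PiM_std_gauss[OF B(1)]) measurable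
  define \<Psi> where "\<Psi> t w = P w * (ennreal (gauss_density (s w + c *\<^sub>R t)) * g (w(b := s w + c *\<^sub>R t)))" for t :: 'a and w
  have [measurable]: "\<Psi> t \<in> borel_measurable (PiM B (\<lambda>_. borel))" for t
    unfolding \<Psi>_def[abs_def] by measurable
  have meas\<Psi>: "(\<lambda>(w, t). \<Psi> t w) \<in> borel_measurable (PiM B (\<lambda>_. borel) \<Otimes>\<^sub>M borel)"
    unfolding \<Psi>_def[abs_def] split_beta by measurable
  then have meas\<Psi>': "(\<lambda>(w, t). \<Psi> t w) \<in> borel_measurable (PiM B (\<lambda>_. lborel) \<Otimes>\<^sub>M lborel)"
    unfolding measurable_cong_sets[OF sets_pair_measure_cong[OF sets_PiM_lborel sets_lborel] refl] .
  have shift: "\<Psi> t (\<lambda>a\<in>B. w a + v a *\<^sub>R t) = ennreal (exp (- K * (norm t)\<^sup>2 / 2)) *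
      (P w * (ennreal (gauss_density (s w)) * g (w(b := s w))))"
    if w: "w \<in> extensional B" for t w
  proof -
    let ?w = "\<lambda>a\<in>B. w a + v a *\<^sub>R t"
    have "s ?w = s w - ((\<Sum>a\<in>B. (v a)\<^sup>2) / v b) *\<^sub>R t"
      by (simp add: s_def' scaleR_add_right sum.distrib scaleR_sum_left power2_eq_square sum_divide_distrib scaleR_sum_right)
    then have s1: "s ?w + c *\<^sub>R t = s w + v b *\<^sub>R t"
      using vb by (simp add: c_def KB add_divide_distrib power2_eq_square scaleR_add_left)
    have eq: "?w(b := s w + v b *\<^sub>R t) = (\<lambda>a\<in>A. (w(b := s w)) a + v a *\<^sub>R t)"
      using B by (auto simp: fun_eq_iff)
    have ext: "w(b := s w) \<in> extensional A"
      using w B by (auto simp: extensional_def)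
    have g1: "g (?w(b := s w + v b *\<^sub>R t)) = g (w(b := s w))"
      unfolding eq by (rule inv[OF ext])
    have orth: "(\<Sum>a\<in>B. v a * (w a \<bullet> t)) + v b * (s w \<bullet> t) = 0"
      using vb by (simp add: s_def' inner_sum_left)
    have gd: "gauss_density (y + r *\<^sub>R t) = gauss_density y * exp (- (r * (y \<bullet> t)) - r\<^sup>2 * (norm t)\<^sup>2 / 2)" for y :: 'a and r
    proof -
      have "(norm (y + r *\<^sub>R t))\<^sup>2 = (norm y)\<^sup>2 + 2 * (r * (y \<bullet> t)) + r\<^sup>2 * (norm t)\<^sup>2"
        unfolding power2_norm_eq_inner by (simp add: algebra_simps inner_commute power2_eq_square)
      then show ?thesis
        by (simp add: gauss_density_def exp_add[symmetric] field_simps)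
    qed
    have "(\<Prod>a\<in>B. gauss_density (?w a)) * gauss_density (s w + v b *\<^sub>R t) =
        ((\<Prod>a\<in>B. gauss_density (w a)) * gauss_density (s w)) *
        (exp (\<Sum>a\<in>B. - (v a * (w a \<bullet> t)) - (v a)\<^sup>2 * (norm t)\<^sup>2 / 2) * exp (- (v b * (s w \<bullet> t)) - (v b)\<^sup>2 * (norm t)\<^sup>2 / 2))"
      unfolding exp_sum[OF B(1)] by (simp add: gd prod.distrib)
    also have "exp (\<Sum>a\<in>B. - (v a * (w a \<bullet> t)) - (v a)\<^sup>2 * (norm t)\<^sup>2 / 2) * exp (- (v b * (s w \<bullet> t)) - (v b)\<^sup>2 * (norm t)\<^sup>2 / 2)
       = exp (- ((\<Sum>a\<in>B. v a * (w a \<bullet> t)) + v b * (s w \<bullet> t)) - K * (norm t)\<^sup>2 / 2)"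
      unfolding KB exp_add[symmetric]
      by (simp add: sum_subtractf sum_negf sum_divide_distrib[symmetric] sum_distrib_left algebra_simps add_divide_distrib)
    also have "\<dots> = exp (- K * (norm t)\<^sup>2 / 2)" by (simp add: orth)
    finally have dens: "(\<Prod>a\<in>B. gauss_density (?w a)) * gauss_density (s w + v b *\<^sub>R t) =
      exp (- K * (norm t)\<^sup>2 / 2) * ((\<Prod>a\<in>B. gauss_density (w a)) * gauss_density (s w))" by (simp add: mult.commute)
    have Pp: "P w' = ennreal (\<Prod>a\<in>B. gauss_density (w' a))" for w'
      unfolding P_def by (simp add: prod_ennreal)
    have nn: "0 \<le> (\<Prod>a\<in>B. gauss_density (w' a))" for w' :: "'b \<Rightarrow> 'a"
      by (simp add: prod_nonneg)
    have "P ?w * ennreal (gauss_density (s w + v b *\<^sub>R t)) =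
       ennreal (exp (- K * (norm t)\<^sup>2 / 2)) * (P w * ennreal (gauss_density (s w)))"
      unfolding Pp using dens nn by (simp only: ennreal_mult[symmetric] gauss_density_nonneg exp_ge_zero mult_nonneg_nonneg)
    then show ?thesis
      unfolding \<Psi>_def s1 g1 by (metis mult.assoc)
  qed
  have "(\<integral>\<^sup>+w. g w \<partial>PiM A (\<lambda>_. std_gauss)) =
      (\<integral>\<^sup>+w. (\<integral>\<^sup>+y. g (w(b := y)) \<partial>std_gauss) \<partial>PiM B (\<lambda>_. std_gauss))"
    unfolding B(3)[symmetric] using B g by (intro G.product_nn_integral_insert) auto
  also have "\<dots> = (\<integral>\<^sup>+w. (\<integral>\<^sup>+y. ennreal (gauss_density y) * g (w(b := y)) \<partial>lborel) \<partial>PiM B (\<lambda>_. std_gauss))"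
  proof (rule nn_integral_cong)
    fix w :: "'b \<Rightarrow> 'a" assume "w \<in> space (PiM B (\<lambda>_. std_gauss))"
    then have [measurable]: "(\<lambda>y. w) \<in> measurable borel (PiM B (\<lambda>_. borel :: 'a measure))"
      by (intro measurable_const) (simp add: space_PiM)
    show "(\<integral>\<^sup>+y. g (w(b := y)) \<partial>std_gauss) = (\<integral>\<^sup>+y. ennreal (gauss_density y) * g (w(b := y)) \<partial>lborel)"
      by (rule nn_integral_std_gauss) measurable
  qed
  also have "\<dots> = (\<integral>\<^sup>+w. P w * (\<integral>\<^sup>+y. ennreal (gauss_density y) * g (w(b := y)) \<partial>lborel) \<partial>PiM B (\<lambda>_. lborel))"
    unfolding P_def by (rule nn_integral_PiM_std_gauss[OF B(1)]) measurable
  \<comment> \<open>For fixed \<open>w\<close> the coordinate \<open>b\<close> is replaced by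
    \<open>t\<close> through \<open>y = s w + c *\<^sub>R t\<close>; \<open>c ^ ?m\<close> is the
    Jacobian.\<close>
  also have "\<dots> = (\<integral>\<^sup>+w. ennreal (c ^ ?m) * (\<integral>\<^sup>+t. \<Psi> t w \<partial>lborel) \<partial>PiM B (\<lambda>_. lborel))"
  proof (rule nn_integral_cong)
    fix w :: "'b \<Rightarrow> 'a" assume w: "w \<in> space (PiM B (\<lambda>_. lborel))"
    then have [measurable]: "(\<lambda>y. w) \<in> measurable borel (PiM B (\<lambda>_. borel :: 'a measure))"
      by (intro measurable_const) (simp add: space_PiM)
    have "(\<integral>\<^sup>+y. ennreal (gauss_density y) * g (w(b := y)) \<partial>lborel) =
       ennreal (\<bar>c\<bar> ^ ?m) * (\<integral>\<^sup>+t. ennreal (gauss_density (s w + c *\<^sub>R t)) * g (w(b := s w + c *\<^sub>R t)) \<partial>lborel)"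
      using c by (intro nn_integral_lborel_affine) auto
    moreover have "(\<integral>\<^sup>+t. \<Psi> t w \<partial>lborel) = P w * (\<integral>\<^sup>+t. ennreal (gauss_density (s w + c *\<^sub>R t)) * g (w(b := s w + c *\<^sub>R t)) \<partial>lborel)"
      unfolding \<Psi>_def by (rule nn_integral_cmult) measurable
    ultimately show "P w * (\<integral>\<^sup>+y. ennreal (gauss_density y) * g (w(b := y)) \<partial>lborel) = ennreal (c ^ ?m) * (\<integral>\<^sup>+t. \<Psi> t w \<partial>lborel)"
      using c by (simp add: mult.left_commute)
  qed
  also have "\<dots> = ennreal (c ^ ?m) * (\<integral>\<^sup>+w. (\<integral>\<^sup>+t. \<Psi> t w \<partial>lborel) \<partial>PiM B (\<lambda>_. lborel))"
    by (intro nn_integral_cmult lborel.borel_measurable_nn_integral meas\<Psi>')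
  \<comment> \<open>The order is exchanged so that \<open>t\<close> is fixed while the remaining
    coordinates are translated by multiples of it.\<close>
  also have "(\<integral>\<^sup>+w. (\<integral>\<^sup>+t. \<Psi> t w \<partial>lborel) \<partial>PiM B (\<lambda>_. lborel)) = (\<integral>\<^sup>+t. (\<integral>\<^sup>+w. \<Psi> t w \<partial>PiM B (\<lambda>_. lborel)) \<partial>lborel)"
    by (rule P.Fubini'[OF meas\<Psi>', symmetric])
  also have "\<dots> = (\<integral>\<^sup>+t. ennreal (exp (- K * (norm (t::'a))\<^sup>2 / 2)) * I \<partial>lborel)"
  proof (rule nn_integral_cong)
    fix t :: 'a
    have "(\<integral>\<^sup>+w. \<Psi> t w \<partial>PiM B (\<lambda>_. lborel)) = (\<integral>\<^sup>+w. \<Psi> t (\<lambda>a\<in>B. w a + v a *\<^sub>R t) \<partial>PiM B (\<lambda>_. lborel))"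
      by (rule nn_integral_PiM_lborel_translate[OF B(1), symmetric]) measurable
    also have "\<dots> = (\<integral>\<^sup>+w. ennreal (exp (- K * (norm t)\<^sup>2 / 2)) *
      (P w * (ennreal (gauss_density (s w)) * g (w(b := s w)))) \<partial>PiM B (\<lambda>_. lborel))"
      by (rule nn_integral_cong, rule shift) (simp add: space_PiM PiE_def)
    also have "\<dots> = ennreal (exp (- K * (norm t)\<^sup>2 / 2)) * I"
      unfolding I_eq by (rule nn_integral_cmult) measurable
    finally show "(\<integral>\<^sup>+w. \<Psi> t w \<partial>PiM B (\<lambda>_. lborel)) = ennreal (exp (- K * (norm t)\<^sup>2 / 2)) * I" .
  qed
  also have "\<dots> = ennreal (sqrt (2 * pi / K) ^ ?m) * I"
    unfolding nn_integral_exp_norm_sq[OF K, where 'a='a, symmetric] by (rule nn_integral_multc) measurable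
  also have "ennreal (c ^ ?m) * (ennreal (sqrt (2 * pi / K) ^ ?m) * I) = ennreal ((sqrt (2 * pi * K) / v b) ^ ?m) * I"
  proof -
    have "c * sqrt (2 * pi / K) = sqrt (2 * pi * K) / v b"
    proof -
      have "c * sqrt (2 * pi / K) = K / sqrt K * sqrt (2 * pi) / v b"
        by (simp add: c_def real_sqrt_divide)
      also have "K / sqrt K = sqrt K" using K by (simp add: real_div_sqrt)
      finally show ?thesis by (simp add: real_sqrt_mult mult.commute)
    qed
    then show ?thesis
      using c K by (simp add: mult.assoc[symmetric] ennreal_mult[symmetric] power_mult_distrib[symmetric])
  qed
  finally show ?thesis unfolding I_def B_def .
qed

subsection \<open>Reduction to Gaussian vectors\<close>

lemma measure_eqI_box:
  fixes M N :: "'a::euclidean_space measure"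
  assumes "finite_measure M" and sets: "sets M = sets borel" "sets N = sets borel"
    and eq: "\<And>l u. emeasure M (box l u) = emeasure N (box l u)"
  shows "M = N"
proof (rule measure_eqI_generator_eq)
  let ?E = "range (\<lambda>(a, b). box a b::'a set)"
  show "Int_stable ?E"
    by (auto simp: Int_stable_def box_Int_box)
  show "?E \<subseteq> Pow UNIV" "sets M = sigma_sets UNIV ?E" "sets N = sigma_sets UNIV ?E"
    by (simp_all add: borel_eq_box sets)
  let ?A = "\<lambda>n::nat. box (- (real n *\<^sub>R One)) (real n *\<^sub>R One) :: 'a set"
  show "range ?A \<subseteq> ?E" "(\<Union>i. ?A i) = UNIV"
    unfolding UN_box_eq_UNIV by auto
  show "emeasure M (?A i) \<noteq> \<infinity>" for i
    using finite_measure.emeasure_finite[OF assms(1)] by simp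
  show "emeasure M X = emeasure N X" if "X \<in> ?E" for X
    using that eq by auto
qed

lemma emeasure_std_gauss_box:
  fixes l u :: "real^'n"
  shows "emeasure std_gauss (box l u) =
    (\<Prod>i\<in>UNIV. emeasure (density lborel (\<lambda>t. ennreal (std_normal_density t))) {l $ i <..< u $ i})"
proof -
  have ind: "indicator (box l u) y = (\<Prod>b\<in>Basis. indicator {l \<bullet> b <..< u \<bullet> b} (y \<bullet> b) :: ennreal)" for y
  proof (cases "y \<in> box l u")
    case True
    then show ?thesis by (auto simp: mem_box)
  next
    case False
    then obtain b where "b \<in> Basis" "y \<bullet> b \<notin> {l \<bullet> b <..< u \<bullet> b}" by (auto simp: mem_box)
    with False show ?thesis by (auto simp: prod_zero_iff indicator_def)
  qed
  have "emeasure std_gauss (box l u) = (\<integral>\<^sup>+y. indicator (box l u) y \<partial>std_gauss)"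
    by simp
  also have "\<dots> = (\<integral>\<^sup>+y. (\<Prod>b\<in>Basis. indicator {l \<bullet> b <..< u \<bullet> b} (y \<bullet> b)) \<partial>std_gauss)"
    by (simp only: ind)
  also have "\<dots> = (\<Prod>b\<in>Basis. \<integral>\<^sup>+t. ennreal (std_normal_density t) * indicator {l \<bullet> b <..< u \<bullet> b} t \<partial>lborel)"
    by (rule nn_integral_std_gauss_prod) auto
  also have "\<dots> = (\<Prod>b\<in>Basis. emeasure (density lborel (\<lambda>t. ennreal (std_normal_density t))) {l \<bullet> b <..< u \<bullet> b})"
    by (intro prod.cong refl) (simp add: emeasure_density)
  finally show ?thesis
    unfolding prod_Basis_vec by (simp add: inner_axis)
qed

text \<open>Two kinds of independence are merged: that of the coefficients within a copy, which is
  assumed, and that of the copies, which the product space provides. Together they make all scalars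
  indexed by \<open>A \<times> UNIV\<close> independent; regrouping them by \<open>a\<close> gives
  independent vectors.\<close>

lemma distr_PiM_vec_std_gauss:
  fixes \<xi> :: "'b \<Rightarrow> 'w \<Rightarrow> real"
  assumes M: "prob_space M" and A: "finite A" "A \<noteq> {}"
    and indep: "prob_space.indep_vars M (\<lambda>_. borel) \<xi> A"
    and dist: "\<And>a. a \<in> A \<Longrightarrow> distributed M lborel (\<xi> a) std_normal_density"
  shows "distr (PiM (UNIV :: 'n::finite set) (\<lambda>_. M)) (PiM A (\<lambda>_. borel)) (\<lambda>\<omega>. \<lambda>a\<in>A. \<chi> i. \<xi> a (\<omega> i))
     = PiM A (\<lambda>_. std_gauss :: (real^'n) measure)"
proof -
  interpret M: prob_space M by fact
  let ?\<Omega> = "PiM (UNIV :: 'n set) (\<lambda>_. M)"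
  let ?N = "density lborel (\<lambda>t. ennreal (std_normal_density t))"
  interpret \<Omega>: product_prob_space "\<lambda>_. M" "UNIV :: 'n set" ..
  have [measurable]: "\<xi> a \<in> borel_measurable M" if "a \<in> A" for a
    using distributed_measurable[OF dist[OF that]] by simp
  have dN: "distr M borel (\<xi> a) = ?N" if "a \<in> A" for a
    using distributed_distr_eq_density[OF dist[OF that]] by (simp cong: distr_cong)
  have prN: "prob_space ?N"
    using prob_space_normal_density[of 1 0] by simp
  interpret N: product_prob_space "\<lambda>_. ?N" "A \<times> (UNIV :: 'n set)"
    by (intro product_prob_spaceI prN)
  interpret NA: product_prob_space "\<lambda>_. ?N" A
    by (intro product_prob_spaceI prN)
  \<comment> \<open>This is independence within a single copy, in the form that is used below as the
    measure of one factor of the product space.\<close>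
  have joint: "emeasure M {m\<in>space M. \<forall>a\<in>A. \<xi> a m \<in> X a} = (\<Prod>a\<in>A. emeasure ?N (X a))"
    if X: "\<And>a. a \<in> A \<Longrightarrow> X a \<in> sets borel" for X
  proof -
    have "distr M (PiM A (\<lambda>_. borel)) (\<lambda>x. \<lambda>i\<in>A. \<xi> i x) = PiM A (\<lambda>i. distr M borel (\<xi> i))"
      using indep by (subst (asm) M.indep_vars_iff_distr_eq_PiM'[OF A(2)]) auto
    also have "\<dots> = PiM A (\<lambda>_. ?N)" by (intro PiM_cong dN) auto
    finally have d: "distr M (PiM A (\<lambda>_. borel)) (\<lambda>x. \<lambda>i\<in>A. \<xi> i x) = PiM A (\<lambda>_. ?N)" .
    have "(\<Prod>a\<in>A. emeasure ?N (X a)) = emeasure (PiM A (\<lambda>_. ?N)) (Pi\<^sub>E A X)"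
      using X A by (intro NA.emeasure_PiM[symmetric]) auto
    also have "\<dots> = emeasure M ((\<lambda>x. \<lambda>i\<in>A. \<xi> i x) -` Pi\<^sub>E A X \<inter> space M)"
      unfolding d[symmetric] using X A
      by (intro emeasure_distr measurable_restrict sets_PiM_I_finite) auto
    also have "(\<lambda>x. \<lambda>i\<in>A. \<xi> i x) -` Pi\<^sub>E A X \<inter> space M = {m\<in>space M. \<forall>a\<in>A. \<xi> a m \<in> X a}"
      by auto
    finally show ?thesis by simp
  qed
  let ?Z = "\<lambda>p \<omega>. \<xi> (fst p) (\<omega> (snd p)) :: real"
  have Zm: "?Z p \<in> borel_measurable ?\<Omega>" if "p \<in> A \<times> UNIV" for p
    using that by (intro measurable_compose[OF measurable_component_singleton]) auto
  have Zd: "distr ?\<Omega> borel (?Z p) = ?N" if "p \<in> A \<times> UNIV" for p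
  proof -
    have "distr ?\<Omega> borel (?Z p) = distr (distr ?\<Omega> M (\<lambda>\<omega>. \<omega> (snd p))) borel (\<xi> (fst p))"
      using that by (subst distr_distr) (auto simp: o_def)
    also have "distr ?\<Omega> M (\<lambda>\<omega>. \<omega> (snd p)) = M"
      by (rule distr_PiM_component) (auto intro: M)
    finally show ?thesis using that dN by auto
  qed
  have Zind: "\<Omega>.indep_vars (\<lambda>_. borel) ?Z (A \<times> UNIV)"
  proof (subst \<Omega>.indep_vars_iff_distr_eq_PiM')
    have "distr ?\<Omega> (PiM (A \<times> UNIV) (\<lambda>_. borel)) (\<lambda>\<omega>. \<lambda>p\<in>A \<times> UNIV. ?Z p \<omega>) = PiM (A \<times> UNIV) (\<lambda>_. ?N)"
    proof (rule N.PiM_eqI)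
      fix X :: "'b \<times> 'n \<Rightarrow> real set" assume X: "\<And>p. p \<in> A \<times> UNIV \<Longrightarrow> X p \<in> sets ?N"
      have "emeasure (distr ?\<Omega> (PiM (A \<times> UNIV) (\<lambda>_. borel)) (\<lambda>\<omega>. \<lambda>p\<in>A \<times> UNIV. ?Z p \<omega>)) (Pi\<^sub>E (A \<times> UNIV) X)
          = emeasure ?\<Omega> ((\<lambda>\<omega>. \<lambda>p\<in>A \<times> UNIV. ?Z p \<omega>) -` Pi\<^sub>E (A \<times> UNIV) X \<inter> space ?\<Omega>)"
        using X A Zm by (intro emeasure_distr measurable_restrict sets_PiM_I_finite) auto
      also have "(\<lambda>\<omega>. \<lambda>p\<in>A \<times> UNIV. ?Z p \<omega>) -` Pi\<^sub>E (A \<times> UNIV) X \<inter> space ?\<Omega> =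
          (\<Pi>\<^sub>E i\<in>UNIV. {m\<in>space M. \<forall>a\<in>A. \<xi> a m \<in> X (a, i)})"
        by (auto simp: space_PiM PiE_iff)
      also have "emeasure ?\<Omega> \<dots> = (\<Prod>i\<in>UNIV. emeasure M {m\<in>space M. \<forall>a\<in>A. \<xi> a m \<in> X (a, i)})"
      proof (rule \<Omega>.emeasure_PiM)
        fix i :: 'n
        have "X (a, i) \<in> sets borel" if "a \<in> A" for a using X[of "(a, i)"] that by simp
        then show "{m\<in>space M. \<forall>a\<in>A. \<xi> a m \<in> X (a, i)} \<in> sets M"
          using A(1) by measurable
      qed simp
      also have "\<dots> = (\<Prod>i\<in>UNIV. \<Prod>a\<in>A. emeasure ?N (X (a, i)))"
        using X by (intro prod.cong joint) auto
      also have "\<dots> = (\<Prod>p\<in>A \<times> UNIV. emeasure ?N (X p))"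
        by (subst prod.swap) (simp add: prod.cartesian_product split_beta)
      finally show "emeasure (distr ?\<Omega> (PiM (A \<times> UNIV) (\<lambda>_. borel)) (\<lambda>\<omega>. \<lambda>p\<in>A \<times> UNIV. ?Z p \<omega>)) (Pi\<^sub>E (A \<times> UNIV) X)
          = (\<Prod>p\<in>A \<times> UNIV. emeasure ?N (X p))" .
    qed (use A in \<open>auto intro!: sets_PiM_cong\<close>)
    also have "\<dots> = PiM (A \<times> UNIV) (\<lambda>p. distr ?\<Omega> borel (?Z p))"
      by (intro PiM_cong Zd[symmetric]) auto
    finally show "distr ?\<Omega> (PiM (A \<times> UNIV) (\<lambda>_. borel)) (\<lambda>\<omega>. \<lambda>p\<in>A \<times> UNIV. ?Z p \<omega>) =
      PiM (A \<times> UNIV) (\<lambda>p. distr ?\<Omega> borel (?Z p))" .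
  qed (use A Zm in auto)
  define Y where "Y a \<omega> = (\<chi> i. \<xi> a (\<omega> i))" for a and \<omega> :: "'n \<Rightarrow> 'w"
  have vec_meas: "(\<lambda>w. \<chi> i. h w $ i) \<in> borel_measurable N"
    if "\<And>i. (\<lambda>w. h w $ i) \<in> borel_measurable N" for h :: "'x \<Rightarrow> real^'n" and N
    using that by (subst borel_measurable_euclidean_space) (auto simp: Basis_vec_def inner_axis)
  have Ym: "Y a \<in> borel_measurable ?\<Omega>" if "a \<in> A" for a
    using vec_meas[of "Y a"] Zm[of "(a, _)"] that by (simp add: Y_def[abs_def])
  \<comment> \<open>The vector \<open>Y a\<close> is a function of the block
    \<open>{a} \<times> UNIV\<close>, and functions of disjoint blocks of an independent family are
    independent.\<close>
  have Yind: "\<Omega>.indep_vars (\<lambda>_. borel) Y A"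
  proof -
    have "\<Omega>.indep_vars (\<lambda>a. PiM ({a} \<times> UNIV) (\<lambda>_. borel)) (\<lambda>a \<omega>. restrict (\<lambda>p. ?Z p \<omega>) ({a} \<times> UNIV)) A"
      by (rule \<Omega>.indep_vars_restrict[OF Zind]) (auto simp: disjoint_family_on_def)
    then have "\<Omega>.indep_vars (\<lambda>_. borel) (\<lambda>a \<omega>. (\<lambda>f. \<chi> i. f (a, i)) (restrict (\<lambda>p. ?Z p \<omega>) ({a} \<times> UNIV))) A"
    proof (rule \<Omega>.indep_vars_compose2)
      fix a assume "a \<in> A"
      show "(\<lambda>f. \<chi> i. f (a, i)) \<in> measurable (PiM ({a} \<times> UNIV) (\<lambda>_. borel)) (borel :: (real^'n) measure)"
        using vec_meas[of "\<lambda>f. \<chi> i. f (a, i)"] by simp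
    qed
    then show ?thesis by (simp add: Y_def[abs_def])
  qed
  have Yd: "distr ?\<Omega> borel (Y a) = std_gauss" if a: "a \<in> A" for a
  proof (rule measure_eqI_box)
    show "finite_measure (distr ?\<Omega> borel (Y a))"
      using Ym[OF a] by (intro prob_space.finite_measure \<Omega>.prob_space_distr)
    fix l u :: "real^'n"
    have "emeasure (distr ?\<Omega> borel (Y a)) (box l u) = emeasure ?\<Omega> (Y a -` box l u \<inter> space ?\<Omega>)"
      using Ym[OF a] by (intro emeasure_distr) auto
    also have "Y a -` box l u \<inter> space ?\<Omega> = (\<Pi>\<^sub>E i\<in>UNIV. \<xi> a -` {l $ i <..< u $ i} \<inter> space M)"
      by (auto simp: Y_def mem_box_cart space_PiM PiE_iff)
    also have "emeasure ?\<Omega> \<dots> = (\<Prod>i\<in>UNIV. emeasure M (\<xi> a -` {l $ i <..< u $ i} \<inter> space M))"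
      using a by (intro \<Omega>.emeasure_PiM) auto
    also have "\<dots> = (\<Prod>i\<in>UNIV. emeasure (distr M borel (\<xi> a)) {l $ i <..< u $ i})"
      using a by (intro prod.cong emeasure_distr[symmetric]) auto
    finally show "emeasure (distr ?\<Omega> borel (Y a)) (box l u) = emeasure std_gauss (box l u)"
      by (simp add: emeasure_std_gauss_box dN[OF a])
  qed auto
  have "distr ?\<Omega> (PiM A (\<lambda>_. borel)) (\<lambda>\<omega>. \<lambda>a\<in>A. Y a \<omega>) = PiM A (\<lambda>a. distr ?\<Omega> borel (Y a))"
    using Yind Ym by (subst (asm) \<Omega>.indep_vars_iff_distr_eq_PiM'[OF A(2)]) auto
  also have "\<dots> = PiM A (\<lambda>_. std_gauss)" by (intro PiM_cong Yd) auto
  finally show ?thesis by (simp only: Y_def)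
qed

lemma measurable_exp_sum_zero_count:
  fixes A :: "(real^'n) set"
  assumes "open U"
  shows "(\<lambda>w. emeasure (count_space UNIV) {x\<in>U. (\<Sum>a\<in>A. (\<alpha> a * exp (a \<bullet> x)) *\<^sub>R w a) = (0::real^'n)})
    \<in> borel_measurable (PiM A (\<lambda>_. borel))"
  by (rule measurable_zero_count[OF assms]) (auto intro!: continuous_intros)

text \<open>The \<open>m\<close> scalar equations form one vector equation with Gaussian vector
  coefficients. From here on the original probability space is no longer visible.\<close>

lemma ES_exp_sum_eq_nn_integral:
  fixes A :: "(real^'n) set" and M :: "'w measure" and \<xi> :: "real^'n \<Rightarrow> 'w \<Rightarrow> real"
  assumes M: "prob_space M" and A: "finite A" "A \<noteq> {}"
    and indep: "prob_space.indep_vars M (\<lambda>_. borel) \<xi> A"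
    and dist: "\<And>a. a \<in> A \<Longrightarrow> distributed M lborel (\<xi> a) std_normal_density"
    and U: "open U"
  shows "ES M (exp_sum A \<alpha> \<xi>) U =
    (\<integral>\<^sup>+w. emeasure (count_space UNIV) {x\<in>U. (\<Sum>a\<in>A. (\<alpha> a * exp (a \<bullet> x)) *\<^sub>R w a) = (0::real^'n)}
      \<partial>PiM A (\<lambda>_. std_gauss))"
proof -
  have zero: "(\<forall>i. exp_sum A \<alpha> \<xi> (\<omega> i) x = 0) \<longleftrightarrow>
     (\<Sum>a\<in>A. (\<alpha> a * exp (a \<bullet> x)) *\<^sub>R (\<lambda>a\<in>A. \<chi> i. \<xi> a (\<omega> i)) a) = (0::real^'n)" for \<omega> :: "'n \<Rightarrow> 'w" and x
    by (simp add: exp_sum_def vec_eq_iff mult_ac)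
  have [measurable]: "\<xi> a \<in> borel_measurable M" if "a \<in> A" for a
    using distributed_measurable[OF dist[OF that]] by simp
  have meas: "(\<lambda>\<omega>. \<lambda>a\<in>A. (\<chi> i. \<xi> a (\<omega> i)) :: real^'n) \<in> measurable (PiM (UNIV :: 'n set) (\<lambda>_. M)) (PiM A (\<lambda>_. borel))"
  proof (rule measurable_restrict)
    fix a assume "a \<in> A"
    then have [measurable]: "\<xi> a \<in> borel_measurable M" by simp
    show "(\<lambda>\<omega>. (\<chi> i. \<xi> a (\<omega> i)) :: real^'n) \<in> borel_measurable (PiM (UNIV :: 'n set) (\<lambda>_. M))"
      by (subst borel_measurable_euclidean_space) (auto simp: Basis_vec_def inner_axis)
  qed
  have distr: "PiM A (\<lambda>_. std_gauss :: (real^'n) measure) =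
     distr (PiM (UNIV :: 'n set) (\<lambda>_. M)) (PiM A (\<lambda>_. borel)) (\<lambda>\<omega>. \<lambda>a\<in>A. \<chi> i. \<xi> a (\<omega> i))"
    by (rule distr_PiM_vec_std_gauss[symmetric]) fact+
  show ?thesis
    unfolding ES_def zero distr
    by (rule nn_integral_distr[symmetric, OF meas]) (subst measurable_distr_eq1, rule measurable_exp_sum_zero_count[OF U])
qed

subsection \<open>The density of zeros\<close>

text \<open>The sum of the rank-one matrices with column factor \<open>w a\<close> and row factor
  \<open>c a\<close>. Rows belong to the equations and columns to the coordinates of the point, so
  that Jacobians of the random system have this shape.\<close>

definition outer_sum :: "'b set \<Rightarrow> ('b \<Rightarrow> real^'n) \<Rightarrow> ('b \<Rightarrow> real^'n) \<Rightarrow> real^'n^'n" where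
  "outer_sum A c w = (\<chi> i j. \<Sum>a\<in>A. w a $ i * c a $ j)"

definition mean_abs_det :: "'b set \<Rightarrow> ('b \<Rightarrow> real^'n) \<Rightarrow> ennreal" where
  "mean_abs_det A c = (\<integral>\<^sup>+w. ennreal \<bar>det (outer_sum A c w)\<bar> \<partial>PiM A (\<lambda>_. std_gauss))"

lemma outer_sum_mult: "outer_sum A c w *v h = (\<Sum>a\<in>A. (c a \<bullet> h) *\<^sub>R w a)"
  unfolding outer_sum_def matrix_vector_mult_def inner_vec_def vec_eq_iff
  by (auto simp: sum_distrib_left sum_distrib_right mult_ac intro: sum.swap)

lemma abs_det_scaleR:
  fixes M :: "real^'n^'n"
  shows "\<bar>det (\<chi> i j. r * M $ i $ j)\<bar> = \<bar>r\<bar> ^ CARD('n) * \<bar>det M\<bar>"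
proof -
  have "(\<chi> i j. r * M $ i $ j) = (\<chi> i. r *s M $ i)"
    by (simp add: vec_eq_iff)
  then show ?thesis
    using det_rows_mul[of "\<lambda>_. r" "\<lambda>i. M $ i"] by (simp add: abs_mult power_abs)
qed

lemma borel_measurable_vec_nth_comp:
  fixes f :: "'x \<Rightarrow> real^'n"
  assumes "f \<in> borel_measurable N"
  shows "(\<lambda>x. f x $ i) \<in> borel_measurable N"
  by (rule measurable_compose[OF assms borel_measurable_continuous_onI]) (intro continuous_intros)

lemma borel_measurable_det_outer_sum:
  assumes c: "\<And>a. a \<in> A \<Longrightarrow> (\<lambda>x. c x a) \<in> borel_measurable N"
    and w: "\<And>a. a \<in> A \<Longrightarrow> (\<lambda>x. w x a) \<in> borel_measurable N"
  shows "(\<lambda>x. det (outer_sum A (c x) (w x))) \<in> borel_measurable N"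
  unfolding det_def outer_sum_def vec_lambda_beta
  by (intro borel_measurable_sum borel_measurable_times borel_measurable_const borel_measurable_prod
      borel_measurable_vec_nth_comp c w)

lemma borel_measurable_PiM_component:
  "a \<in> A \<Longrightarrow> (\<lambda>w. w a) \<in> borel_measurable (PiM A (\<lambda>_. borel))"
  by (rule measurable_component_singleton)

section \<open>The Kac-Rice density and its disintegrated form\<close>

definition exp_coeff :: "(real^'n \<Rightarrow> real) \<Rightarrow> real^'n \<Rightarrow> real^'n \<Rightarrow> real" where
  "exp_coeff \<alpha> x a = \<alpha> a * exp (a \<bullet> x)"

definition exp_var :: "(real^'n) set \<Rightarrow> (real^'n \<Rightarrow> real) \<Rightarrow> real^'n \<Rightarrow> real" where
  "exp_var A \<alpha> x = (\<Sum>a\<in>A. (exp_coeff \<alpha> x a)\<^sup>2)"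

text \<open>Half the gradient of \<open>ln (exp_var A \<alpha> x)\<close>. It is also the covariance
  of the gradient with the value of the exponential sum at \<open>x\<close>, divided by the variance
  of the value.\<close>

definition exp_mean :: "(real^'n) set \<Rightarrow> (real^'n \<Rightarrow> real) \<Rightarrow> real^'n \<Rightarrow> real^'n" where
  "exp_mean A \<alpha> x = (1 / exp_var A \<alpha> x) *\<^sub>R (\<Sum>a\<in>A. (exp_coeff \<alpha> x a)\<^sup>2 *\<^sub>R a)"

text \<open>The first factor is the density at 0 of the Gaussian vector of values at
  \<open>x\<close>. The second is the mean absolute Jacobian given that this vector vanishes;
  subtracting \<open>exp_mean\<close> removes the part of the Jacobian correlated with the values,
  so that an unconditional mean can be taken.\<close>

definition zero_density :: "(real^'n) set \<Rightarrow> (real^'n \<Rightarrow> real) \<Rightarrow> real^'n \<Rightarrow> ennreal" where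
  "zero_density A \<alpha> x = ennreal ((1 / sqrt (2 * pi * exp_var A \<alpha> x)) ^ CARD('n)) *
    mean_abs_det A (\<lambda>a. exp_coeff \<alpha> x a *\<^sub>R (a - exp_mean A \<alpha> x))"

lemma exp_coeff_pos: "\<alpha> a > 0 \<Longrightarrow> exp_coeff \<alpha> x a > 0"
  by (simp add: exp_coeff_def)

lemma exp_var_pos:
  assumes "finite A" "A \<noteq> {}" "\<And>a. a \<in> A \<Longrightarrow> \<alpha> a > 0"
  shows "exp_var A \<alpha> x > 0"
  unfolding exp_var_def using assms exp_coeff_pos[of \<alpha> _ x]
  by (intro sum_pos) (auto simp: zero_less_power2 less_imp_neq[symmetric])

text \<open>The left-hand side is what the area formula produces at a fixed point, and it depends on
  the choice of \<open>b\<close>. Reading \<open>std_gauss_disintegration\<close> from right to left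
  turns it into an expression symmetric in \<open>A\<close>.\<close>

lemma zero_density_eq_disintegrated:
  fixes A :: "(real^'n) set" and x :: "real^'n"
  assumes A: "finite A" "b \<in> A" and \<alpha>: "\<And>a. a \<in> A \<Longrightarrow> \<alpha> a > 0"
  defines "s \<equiv> (\<lambda>w. - ((1 / exp_coeff \<alpha> x b) *\<^sub>R (\<Sum>a\<in>A - {b}. exp_coeff \<alpha> x a *\<^sub>R w a)))"
  shows "(\<integral>\<^sup>+w. ennreal (\<bar>det (outer_sum (A - {b}) (\<lambda>a. - ((exp_coeff \<alpha> x a / exp_coeff \<alpha> x b) *\<^sub>R (a - b))) w)\<bar>
        * gauss_density (s w)) \<partial>PiM (A - {b}) (\<lambda>_. std_gauss)) = zero_density A \<alpha> x"
proof -
  let ?v = "exp_coeff \<alpha> x" and ?K = "exp_var A \<alpha> x" and ?\<mu> = "exp_mean A \<alpha> x" and ?m = "CARD('n)"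
  let ?c = "\<lambda>a. ?v a *\<^sub>R (a - ?\<mu>)" and ?d = "\<lambda>a. - ((?v a / ?v b) *\<^sub>R (a - b))"
  have K: "?K > 0" using A \<alpha> by (intro exp_var_pos) auto
  have vb: "?v b > 0" using A \<alpha> by (intro exp_coeff_pos) auto
  have centred: "(\<Sum>a\<in>A. (?v a)\<^sup>2 *\<^sub>R (a - ?\<mu>)) = 0"
  proof -
    have "(\<Sum>a\<in>A. (?v a)\<^sup>2 *\<^sub>R (a - ?\<mu>)) = (\<Sum>a\<in>A. (?v a)\<^sup>2 *\<^sub>R a) - (\<Sum>a\<in>A. (?v a)\<^sup>2) *\<^sub>R ?\<mu>"
      by (simp add: scaleR_diff_right sum_subtractf scaleR_sum_left)
    also have "(\<Sum>a\<in>A. (?v a)\<^sup>2) *\<^sub>R ?\<mu> = (\<Sum>a\<in>A. (?v a)\<^sup>2 *\<^sub>R a)"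
      unfolding exp_var_def[symmetric] using K by (simp only: exp_mean_def scaleR_scaleR) simp
    finally show ?thesis by simp
  qed
  \<comment> \<open>Adding \<open>?v a *\<^sub>R t\<close> to each vector changes the matrix by a
    product of \<open>t\<close> with the sum in \<open>centred\<close>, which is zero. This is the
    invariance required for the disintegration.\<close>
  have inv: "outer_sum A ?c (\<lambda>a\<in>A. w a + ?v a *\<^sub>R t) = outer_sum A ?c w" for w t
  proof -
    have "(\<Sum>a\<in>A. (w a $ i + ?v a * t $ i) * (?v a * (a $ j - ?\<mu> $ j))) = (\<Sum>a\<in>A. w a $ i * (?v a * (a $ j - ?\<mu> $ j)))" for i j
    proof -
      have "(\<Sum>a\<in>A. (w a $ i + ?v a * t $ i) * (?v a * (a $ j - ?\<mu> $ j))) =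
        (\<Sum>a\<in>A. w a $ i * (?v a * (a $ j - ?\<mu> $ j))) + t $ i * (\<Sum>a\<in>A. (?v a)\<^sup>2 *\<^sub>R (a - ?\<mu>)) $ j"
        by (simp add: sum_component sum_distrib_left sum.distrib[symmetric] power2_eq_square algebra_simps)
      then show ?thesis by (simp add: centred)
    qed
    then show ?thesis by (simp add: outer_sum_def)
  qed
  \<comment> \<open>With \<open>s w\<close> in place \<open>b\<close> the vectors satisfy a linear
    relation with coefficients \<open>?v a\<close> and sum 0, so the base point
    \<open>?\<mu>\<close> may be exchanged for \<open>b\<close> without changing the matrix. Then
    the term of \<open>b\<close> vanishes, and a factor \<open>- ?v b\<close> remains.\<close>
  have det_eq: "\<bar>det (outer_sum A ?c (w(b := s w)))\<bar> = (?v b) ^ ?m * \<bar>det (outer_sum (A - {b}) ?d w)\<bar>" for w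
  proof -
    have "outer_sum A ?c (w(b := s w)) = (\<chi> i j. - ?v b * outer_sum (A - {b}) ?d w $ i $ j)"
    proof -
      have "(\<Sum>a\<in>A. (w(b := s w)) a $ i * ?c a $ j) = - ?v b * (\<Sum>a\<in>A - {b}. w a $ i * ?d a $ j)" for i j
      proof -
        have "(\<Sum>a\<in>A. (w(b := s w)) a $ i * ?c a $ j) =
          s w $ i * ?c b $ j + (\<Sum>a\<in>A - {b}. w a $ i * ?c a $ j)"
          using A by (subst sum.remove[of A b]) (auto intro!: sum.cong)
        also have "s w $ i * ?c b $ j = - (\<Sum>a\<in>A - {b}. ?v a * w a $ i) * (b $ j - ?\<mu> $ j)"
          using vb by (simp add: s_def sum_component)
        also have "\<dots> + (\<Sum>a\<in>A - {b}. w a $ i * ?c a $ j) = (\<Sum>a\<in>A - {b}. w a $ i * (?v a * (a $ j - b $ j)))"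
          unfolding sum_negf[symmetric] sum_distrib_right sum.distrib[symmetric]
          by (intro sum.cong refl) (simp add: algebra_simps)
        also have "\<dots> = - ?v b * (\<Sum>a\<in>A - {b}. w a $ i * ?d a $ j)"
          using vb by (simp add: sum_distrib_left)
        finally show ?thesis .
      qed
      then show ?thesis by (simp add: outer_sum_def)
    qed
    then show ?thesis using vb by (simp only: abs_det_scaleR) simp
  qed
  let ?P = "PiM (A - {b}) (\<lambda>_. std_gauss :: (real^'n) measure)"
  let ?I = "(\<integral>\<^sup>+w. ennreal (\<bar>det (outer_sum (A - {b}) ?d w)\<bar> * gauss_density (s w)) \<partial>?P)"
  have sm: "s \<in> borel_measurable (PiM (A - {b}) (\<lambda>_. borel))"
    unfolding s_def by (intro borel_measurable_uminus borel_measurable_scaleR borel_measurable_const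
      borel_measurable_sum borel_measurable_PiM_component)
  have meas: "(\<lambda>w. ennreal (\<bar>det (outer_sum (A - {b}) ?d w)\<bar> * gauss_density (s w))) \<in> borel_measurable ?P"
  proof -
    have [measurable]: "(\<lambda>w. det (outer_sum (A - {b}) ?d w)) \<in> borel_measurable (PiM (A - {b}) (\<lambda>_. borel))"
      by (intro borel_measurable_det_outer_sum borel_measurable_PiM_component borel_measurable_const)
    note [measurable] = sm
    show ?thesis by measurable
  qed
  have "mean_abs_det A ?c = ennreal ((sqrt (2 * pi * (\<Sum>a\<in>A. (?v a)\<^sup>2)) / ?v b) ^ DIM(real^'n)) *
     (\<integral>\<^sup>+w. ennreal (gauss_density (s w)) * ennreal \<bar>det (outer_sum A ?c (w(b := s w)))\<bar> \<partial>?P)"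
    unfolding mean_abs_det_def s_def
  proof (rule std_gauss_disintegration[where v="?v" and A=A and b=b, OF A vb])
    show "(\<lambda>w. ennreal \<bar>det (outer_sum A ?c w)\<bar>) \<in> borel_measurable (PiM A (\<lambda>_. borel))"
      by (intro measurable_compose[OF _ measurable_ennreal] borel_measurable_abs borel_measurable_det_outer_sum borel_measurable_PiM_component borel_measurable_const)
  qed (simp only: inv)
  also have "(\<integral>\<^sup>+w. ennreal (gauss_density (s w)) * ennreal \<bar>det (outer_sum A ?c (w(b := s w)))\<bar> \<partial>?P) =
     (\<integral>\<^sup>+w. ennreal ((?v b) ^ ?m) * ennreal (\<bar>det (outer_sum (A - {b}) ?d w)\<bar> * gauss_density (s w)) \<partial>?P)"
    unfolding det_eq using vb by (intro nn_integral_cong) (simp add: ennreal_mult mult_ac)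
  also have "\<dots> = ennreal ((?v b) ^ ?m) * ?I"
    by (rule nn_integral_cmult[OF meas])
  also have "ennreal ((sqrt (2 * pi * (\<Sum>a\<in>A. (?v a)\<^sup>2)) / ?v b) ^ DIM(real^'n)) * (ennreal ((?v b) ^ ?m) * ?I) =
     ennreal (sqrt (2 * pi * ?K) ^ ?m) * ?I"
    unfolding exp_var_def[symmetric] using vb K
    by (simp add: mult.assoc[symmetric] ennreal_mult[symmetric] power_mult_distrib[symmetric])
  finally have "ennreal ((1 / sqrt (2 * pi * ?K)) ^ ?m) * mean_abs_det A ?c =
     ennreal ((1 / sqrt (2 * pi * ?K)) ^ ?m) * (ennreal (sqrt (2 * pi * ?K) ^ ?m) * ?I)" by simp
  also have "\<dots> = ?I"
  proof -
    have "(1 / sqrt (2 * pi * ?K)) ^ ?m * sqrt (2 * pi * ?K) ^ ?m = 1"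
      unfolding power_mult_distrib[symmetric] using K by simp
    then show ?thesis
      using K by (simp add: mult.assoc[symmetric] ennreal_mult[symmetric])
  qed
  finally show ?thesis unfolding zero_density_def by simp
qed


text \<open>Once all coefficients other than that of \<open>b\<close> are fixed, \<open>x\<close> is
  a zero exactly if the remaining Gaussian vector equals \<open>g w x\<close>. The expected number
  of zeros becomes a Gaussian integral of a preimage count, and the area formula moves this integral
  to the space of points \<open>x\<close>.\<close>

lemma ES_exp_sum_eq_zero_density:
  fixes A :: "(real^'n) set" and M :: "'w measure" and \<xi> :: "real^'n \<Rightarrow> 'w \<Rightarrow> real"
  assumes M: "prob_space M" and A: "finite A" "A \<noteq> {}"
    and \<alpha>: "\<And>a. a \<in> A \<Longrightarrow> \<alpha> a > 0"
    and indep: "prob_space.indep_vars M (\<lambda>_. borel) \<xi> A"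
    and dist: "\<And>a. a \<in> A \<Longrightarrow> distributed M lborel (\<xi> a) std_normal_density"
    and U: "open U"
  shows "ES M (exp_sum A \<alpha> \<xi>) U = (\<integral>\<^sup>+x. zero_density A \<alpha> x * indicator U x \<partial>lborel)"
proof -
  interpret G: product_sigma_finite "\<lambda>_. std_gauss :: (real^'n) measure"
    by (rule product_sigma_finite_std_gauss)
  obtain b where b: "b \<in> A" using A by auto
  define B where "B = A - {b}"
  have B: "finite B" "b \<notin> B" "insert b B = A" using A b by (auto simp: B_def)
  let ?P = "PiM B (\<lambda>_. std_gauss :: (real^'n) measure)"
  interpret PB: sigma_finite_measure ?P by (rule G.sigma_finite[OF B(1)])
  interpret pair: pair_sigma_finite ?P "lborel :: (real^'n) measure" ..
  define r where "r x a = exp_coeff \<alpha> x a / exp_coeff \<alpha> x b" for x a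
  have vb: "exp_coeff \<alpha> x b > 0" for x using \<alpha> b by (intro exp_coeff_pos) auto
  \<comment> \<open>The quotient is again an exponential, now with exponent \<open>a - b\<close>;
    this makes \<open>g w\<close> smooth with an explicit Jacobian.\<close>
  have r_eq: "r x a = \<alpha> a / \<alpha> b * exp ((a - b) \<bullet> x)" for x a
    by (simp add: r_def exp_coeff_def inner_diff_left exp_diff)
  define d where "d x a = - (r x a *\<^sub>R (a - b))" for x a
  define g where "g w x = - (\<Sum>a\<in>B. r x a *\<^sub>R w a)" for w :: "real^'n \<Rightarrow> real^'n" and x
  define N where "N w = emeasure (count_space UNIV) {x\<in>U. (\<Sum>a\<in>A. (\<alpha> a * exp (a \<bullet> x)) *\<^sub>R w a) = (0::real^'n)}" for w
  have cr: "continuous_on S (\<lambda>x. r x a)" for S a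
    unfolding r_eq by (intro continuous_intros)
  have N_upd: "N (w(b := y)) = emeasure (count_space UNIV) {x\<in>U. g w x = y}" for w y
  proof -
    have "(\<Sum>a\<in>A. (\<alpha> a * exp (a \<bullet> x)) *\<^sub>R (w(b := y)) a) = 0 \<longleftrightarrow> g w x = y" for x
    proof -
      have "(\<Sum>a\<in>A. (\<alpha> a * exp (a \<bullet> x)) *\<^sub>R (w(b := y)) a) =
        exp_coeff \<alpha> x b *\<^sub>R y + (\<Sum>a\<in>B. exp_coeff \<alpha> x a *\<^sub>R w a)"
        using A(1) b unfolding B_def exp_coeff_def by (subst sum.remove[of A b]) (auto intro!: sum.cong)
      also have "(\<Sum>a\<in>B. exp_coeff \<alpha> x a *\<^sub>R w a) = - (exp_coeff \<alpha> x b *\<^sub>R g w x)"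
        using vb[of x] by (simp add: g_def r_def scaleR_sum_right)
      finally show ?thesis using vb[of x] by (auto simp: scaleR_diff_right[symmetric])
    qed
    then show ?thesis by (simp add: N_def)
  qed
  have N_meas: "N \<in> borel_measurable (PiM A (\<lambda>_. borel))"
    unfolding N_def[abs_def] by (rule measurable_exp_sum_zero_count[OF U])
  have der: "(g w has_derivative (*v) (outer_sum B (d x) w)) (at x)" for w x
  proof -
    have "((\<lambda>x. r x a) has_derivative (\<lambda>h. r x a * ((a - b) \<bullet> h))) (at x)" for a
      unfolding r_eq using \<alpha>[OF b] by (auto intro!: derivative_eq_intros)
    then have "(g w has_derivative (\<lambda>h. - (\<Sum>a\<in>B. (r x a * ((a - b) \<bullet> h)) *\<^sub>R w a))) (at x)"
      unfolding g_def[abs_def]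
      by (intro has_derivative_minus has_derivative_sum has_derivative_scaleR_left)
    also have "(\<lambda>h. - (\<Sum>a\<in>B. (r x a * ((a - b) \<bullet> h)) *\<^sub>R w a)) = (*v) (outer_sum B (d x) w)"
      by (rule ext) (simp add: outer_sum_mult d_def sum_negf)
    finally show ?thesis .
  qed
  have cont: "continuous_on UNIV (\<lambda>x. outer_sum B (d x) w)" for w
    unfolding outer_sum_def d_def by (intro continuous_intros cr)
  \<comment> \<open>Measurability in the target \<open>y\<close> is again a case of counting zeros
    of a continuous function, with \<open>y\<close> in the role of the random parameter.\<close>
  have count_meas: "(\<lambda>y. emeasure (count_space UNIV) {x\<in>U. g w x = y}) \<in> borel_measurable borel" for w
  proof -
    have "(\<lambda>y. emeasure (count_space UNIV) {x\<in>U. g w x - y = 0}) \<in> borel_measurable borel"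
    proof (rule measurable_zero_count[OF U])
      fix y :: "real^'n"
      have "continuous_on UNIV (g w)" unfolding g_def[abs_def] by (intro continuous_intros cr)
      then show "continuous_on UNIV (\<lambda>x. g w x - y)" by (intro continuous_intros)
    qed measurable
    then show ?thesis by simp
  qed
  define \<Phi> where "\<Phi> w x = ennreal (\<bar>det (outer_sum B (d x) w)\<bar> * gauss_density (g w x)) * indicator U x" for w x
  have \<Phi>_meas: "(\<lambda>(w, x). \<Phi> w x) \<in> borel_measurable (?P \<Otimes>\<^sub>M lborel)"
  proof -
    have wm: "(\<lambda>p. fst p a) \<in> borel_measurable (?P \<Otimes>\<^sub>M (lborel :: (real^'n) measure))" if "a \<in> B" for a
    proof -
      have "(\<lambda>p. fst p a) \<in> measurable (?P \<Otimes>\<^sub>M (lborel :: (real^'n) measure)) std_gauss"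
        by (rule measurable_compose[OF measurable_fst measurable_component_singleton[OF that]])
      then show ?thesis by (simp only: measurable_cong_sets[OF refl sets_std_gauss])
    qed
    have rm: "(\<lambda>p. r (snd p) a) \<in> borel_measurable (?P \<Otimes>\<^sub>M (lborel :: (real^'n) measure))" for a
      by (rule measurable_compose[OF measurable_snd]) (simp add: borel_measurable_continuous_onI cr)
    have dm: "(\<lambda>p. d (snd p) a) \<in> borel_measurable (?P \<Otimes>\<^sub>M (lborel :: (real^'n) measure))" for a
      unfolding d_def by (intro borel_measurable_uminus borel_measurable_scaleR rm borel_measurable_const)
    have [measurable]: "(\<lambda>p. det (outer_sum B (d (snd p)) (fst p))) \<in> borel_measurable (?P \<Otimes>\<^sub>M (lborel :: (real^'n) measure))"
      by (intro borel_measurable_det_outer_sum dm wm)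
    have [measurable]: "(\<lambda>p. g (fst p) (snd p)) \<in> borel_measurable (?P \<Otimes>\<^sub>M (lborel :: (real^'n) measure))"
      unfolding g_def by (intro borel_measurable_uminus borel_measurable_sum borel_measurable_scaleR rm wm)
    have [measurable]: "U \<in> sets borel" using U by auto
    show ?thesis unfolding \<Phi>_def split_beta by measurable
  qed
  have "ES M (exp_sum A \<alpha> \<xi>) U = (\<integral>\<^sup>+w. N w \<partial>PiM A (\<lambda>_. std_gauss))"
    unfolding N_def by (rule ES_exp_sum_eq_nn_integral) fact+
  also have "\<dots> = (\<integral>\<^sup>+w. (\<integral>\<^sup>+y. N (w(b := y)) \<partial>std_gauss) \<partial>?P)"
    unfolding B(3)[symmetric] using B N_meas
    by (intro G.product_nn_integral_insert) (auto simp: measurable_cong_sets[OF sets_PiM_std_gauss refl])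
  also have "\<dots> = (\<integral>\<^sup>+w. (\<integral>\<^sup>+x. \<Phi> w x \<partial>lborel) \<partial>?P)"
  proof (rule nn_integral_cong)
    fix w
    have "(\<integral>\<^sup>+y. N (w(b := y)) \<partial>std_gauss) =
      (\<integral>\<^sup>+y. ennreal (gauss_density y) * emeasure (count_space UNIV) {x\<in>U. g w x = y} \<partial>lborel)"
      unfolding N_upd by (rule nn_integral_std_gauss[OF count_meas])
    also have "\<dots> = (\<integral>\<^sup>+x. \<Phi> w x \<partial>lborel)"
      unfolding \<Phi>_def
      by (rule area_formula[OF U der cont integrable_gauss_density gauss_density_nonneg count_meas])
    finally show "(\<integral>\<^sup>+y. N (w(b := y)) \<partial>std_gauss) = (\<integral>\<^sup>+x. \<Phi> w x \<partial>lborel)" .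
  qed
  also have "\<dots> = (\<integral>\<^sup>+x. (\<integral>\<^sup>+w. \<Phi> w x \<partial>?P) \<partial>lborel)"
    by (rule pair.Fubini'[OF \<Phi>_meas, symmetric])
  also have "\<dots> = (\<integral>\<^sup>+x. zero_density A \<alpha> x * indicator U x \<partial>lborel)"
  proof (rule nn_integral_cong)
    fix x
    \<comment> \<open>At a fixed point \<open>g w x\<close> is the value \<open>s w\<close> forced
      on the coordinate \<open>b\<close> by the linear relation of the disintegration.\<close>
    have g_alt: "g w x = - ((1 / exp_coeff \<alpha> x b) *\<^sub>R (\<Sum>a\<in>A - {b}. exp_coeff \<alpha> x a *\<^sub>R w a))" for w
      by (simp add: g_def r_def B_def scaleR_sum_right)
    have "(\<integral>\<^sup>+w. ennreal (\<bar>det (outer_sum B (d x) w)\<bar> * gauss_density (g w x)) \<partial>?P) = zero_density A \<alpha> x"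
      unfolding g_alt d_def r_def B_def by (rule zero_density_eq_disintegrated[OF A(1) b \<alpha>])
    then show "(\<integral>\<^sup>+w. \<Phi> w x \<partial>?P) = zero_density A \<alpha> x * indicator U x"
      by (cases "x \<in> U") (simp_all add: \<Phi>_def)
  qed
  finally show ?thesis .
qed

subsection \<open>The mean absolute determinant\<close>

text \<open>Exponentials of absolute values serve as dominating functions because they factor over
  all coordinates, so that their integrability reduces to this one-dimensional moment.\<close>

lemma nn_integral_std_normal_exp_abs_finite:
  "(\<integral>\<^sup>+t. ennreal (std_normal_density t) * ennreal (exp (k * \<bar>t\<bar>)) \<partial>lborel) < \<infinity>"
proof -
  \<comment> \<open>Completing the square: an exponential tilt moves the mean of the normal density
    to \<open>c\<close>.\<close>
  have shift: "std_normal_density t * exp (c * t) = exp (c\<^sup>2 / 2) * normal_density c 1 t" for c t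
    unfolding normal_density_def by (simp add: exp_add[symmetric] power2_eq_square algebra_simps diff_divide_distrib add_divide_distrib)
  have one: "(\<integral>\<^sup>+t. ennreal (normal_density c 1 t) \<partial>lborel) = 1" for c
    using prob_space.emeasure_space_1[OF prob_space_normal_density[of 1 c]]
    by (simp add: emeasure_density)
  have fin: "(\<integral>\<^sup>+t. ennreal (std_normal_density t * exp (c * t)) \<partial>lborel) = ennreal (exp (c\<^sup>2 / 2))" for c
    unfolding shift by (simp add: ennreal_mult nn_integral_cmult one)
  have "(\<integral>\<^sup>+t. ennreal (std_normal_density t) * ennreal (exp (k * \<bar>t\<bar>)) \<partial>lborel) \<le>
    (\<integral>\<^sup>+t. ennreal (std_normal_density t * exp (k * t)) + ennreal (std_normal_density t * exp (- k * t)) \<partial>lborel)"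
  proof (rule nn_integral_mono)
    fix t
    have "exp (k * \<bar>t\<bar>) \<le> exp (k * t) + exp (- k * t)"
      by (cases "t \<ge> 0") (auto simp: add_increasing add_increasing2)
    then have "std_normal_density t * exp (k * \<bar>t\<bar>) \<le> std_normal_density t * exp (k * t) + std_normal_density t * exp (- k * t)"
      by (simp add: distrib_left[symmetric] mult_left_mono del: mult_minus_left)
    then show "ennreal (std_normal_density t) * ennreal (exp (k * \<bar>t\<bar>)) \<le>
      ennreal (std_normal_density t * exp (k * t)) + ennreal (std_normal_density t * exp (- k * t))"
      by (simp add: ennreal_mult[symmetric] ennreal_plus[symmetric] ennreal_leI del: ennreal_plus)
  qed
  also have "\<dots> = ennreal (exp (k\<^sup>2 / 2)) + ennreal (exp ((- k)\<^sup>2 / 2))"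
    unfolding fin[symmetric] by (rule nn_integral_add) auto
  also have "\<dots> < \<infinity>" by simp
  finally show ?thesis .
qed

lemma nn_integral_PiM_std_gauss_exp_finite:
  assumes "finite A"
  shows "(\<integral>\<^sup>+w. ennreal (exp (k * (\<Sum>a\<in>A. \<Sum>b\<in>Basis. \<bar>w a \<bullet> b\<bar>))) \<partial>PiM A (\<lambda>_. std_gauss :: 'a::euclidean_space measure)) < \<infinity>"
proof -
  interpret G: product_sigma_finite "\<lambda>_. std_gauss :: 'a measure" by (rule product_sigma_finite_std_gauss)
  let ?h = "\<lambda>y::'a. \<Prod>b\<in>Basis. ennreal (exp (k * \<bar>y \<bullet> b\<bar>))"
  have "(\<integral>\<^sup>+w. ennreal (exp (k * (\<Sum>a\<in>A. \<Sum>b\<in>Basis. \<bar>w a \<bullet> b\<bar>))) \<partial>PiM A (\<lambda>_. std_gauss :: 'a measure)) =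
     (\<integral>\<^sup>+w. (\<Prod>a\<in>A. ?h (w a)) \<partial>PiM A (\<lambda>_. std_gauss))"
    using assms by (simp add: sum_distrib_left exp_sum prod_ennreal prod_nonneg)
  also have "\<dots> = (\<Prod>a\<in>A. integral\<^sup>N std_gauss ?h)"
    by (rule G.product_nn_integral_prod[OF assms]) measurable
  also have "integral\<^sup>N std_gauss ?h = (\<Prod>b\<in>(Basis :: 'a set). \<integral>\<^sup>+t. ennreal (std_normal_density t) * ennreal (exp (k * \<bar>t\<bar>)) \<partial>lborel)"
    by (rule nn_integral_std_gauss_prod) measurable
  also have "(\<Prod>a\<in>A. (\<Prod>b\<in>(Basis :: 'a set). \<integral>\<^sup>+t. ennreal (std_normal_density t) * ennreal (exp (k * \<bar>t\<bar>)) \<partial>lborel)) < \<infinity>"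
    using nn_integral_std_normal_exp_abs_finite[of k] by (simp add: power_less_top_ennreal)
  finally show ?thesis .
qed

text \<open>Each product in the Leibniz expansion is bounded through its entries. The bound depends
  on \<open>c\<close> only through \<open>C\<close>, so a single function dominates the determinants
  along a whole bounded sequence of families \<open>c\<close>.\<close>

lemma abs_det_outer_sum_le:
  fixes c w :: "'b \<Rightarrow> real^'n"
  assumes A: "finite A" and C: "C \<ge> 0" "\<And>a j. a \<in> A \<Longrightarrow> \<bar>c a $ j\<bar> \<le> C"
  shows "\<bar>det (outer_sum A c w)\<bar> \<le> fact CARD('n) * C ^ CARD('n) * exp (real CARD('n) * (\<Sum>a\<in>A. \<Sum>b\<in>Basis. \<bar>w a \<bullet> b\<bar>))"
proof -
  define S where "S = (\<Sum>a\<in>A. \<Sum>b\<in>Basis. \<bar>w a \<bullet> b\<bar>)"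
  have S: "S \<ge> 0" by (auto simp: S_def intro!: sum_nonneg)
  have entry: "\<bar>outer_sum A c w $ i $ j\<bar> \<le> C * S" for i j
  proof -
    have "\<bar>outer_sum A c w $ i $ j\<bar> \<le> (\<Sum>a\<in>A. \<bar>w a $ i * c a $ j\<bar>)"
      unfolding outer_sum_def by simp
    also have "\<dots> \<le> (\<Sum>a\<in>A. C * (\<Sum>b\<in>Basis. \<bar>w a \<bullet> b\<bar>))"
    proof (rule sum_mono)
      fix a assume a: "a \<in> A"
      have "\<bar>w a $ i\<bar> \<le> norm (w a)" by (rule component_le_norm_cart)
      also have "\<dots> \<le> (\<Sum>b\<in>Basis. \<bar>w a \<bullet> b\<bar>)" by (rule norm_le_l1)
      finally have "\<bar>w a $ i\<bar> * \<bar>c a $ j\<bar> \<le> (\<Sum>b\<in>Basis. \<bar>w a \<bullet> b\<bar>) * C"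
        using C(2)[OF a] by (intro mult_mono) (auto intro: sum_nonneg)
      then show "\<bar>w a $ i * c a $ j\<bar> \<le> C * (\<Sum>b\<in>Basis. \<bar>w a \<bullet> b\<bar>)"
        by (simp add: abs_mult mult.commute)
    qed
    also have "\<dots> = C * S" by (simp add: S_def sum_distrib_left)
    finally show ?thesis .
  qed
  have "\<bar>det (outer_sum A c w)\<bar> \<le> (\<Sum>p | p permutes (UNIV :: 'n set). \<bar>of_int (sign p) * (\<Prod>i\<in>UNIV. outer_sum A c w $ i $ p i)\<bar>)"
    unfolding det_def by (rule sum_abs)
  also have "\<dots> \<le> (\<Sum>p | p permutes (UNIV :: 'n set). (C * S) ^ CARD('n))"
  proof (rule sum_mono)
    fix p :: "'n \<Rightarrow> 'n"
    have "\<bar>of_int (sign p) * (\<Prod>i\<in>UNIV. outer_sum A c w $ i $ p i)\<bar> = (\<Prod>i\<in>UNIV. \<bar>outer_sum A c w $ i $ p i\<bar>)"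
      by (simp add: abs_mult sign_def abs_prod)
    also have "\<dots> \<le> (\<Prod>i\<in>(UNIV :: 'n set). C * S)"
      using entry by (intro prod_mono) auto
    finally show "\<bar>of_int (sign p) * (\<Prod>i\<in>UNIV. outer_sum A c w $ i $ p i)\<bar> \<le> (C * S) ^ CARD('n)" by simp
  qed
  also have "\<dots> = fact CARD('n) * C ^ CARD('n) * S ^ CARD('n)"
    by (simp add: card_permutations[OF refl] power_mult_distrib)
  also have "S ^ CARD('n) \<le> exp S ^ CARD('n)"
    using S exp_ge_add_one_self[of S] by (intro power_mono) linarith+
  finally have "\<bar>det (outer_sum A c w)\<bar> \<le> fact CARD('n) * C ^ CARD('n) * exp S ^ CARD('n)"
    using C(1) by (simp add: mult_left_mono)
  then show ?thesis by (simp add: S_def exp_of_nat_mult)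
qed

lemma borel_measurable_abs_det_outer_sum:
  "(\<lambda>w. ennreal \<bar>det (outer_sum A c w)\<bar>) \<in> borel_measurable (PiM A (\<lambda>_. std_gauss))"
  unfolding measurable_cong_sets[OF sets_PiM_std_gauss refl]
  by (intro measurable_compose[OF _ measurable_ennreal] borel_measurable_abs
      borel_measurable_det_outer_sum borel_measurable_PiM_component borel_measurable_const)

lemma nn_integral_dominating_finite:
  assumes "finite A"
  shows "(\<integral>\<^sup>+w. ennreal (B * exp (k * (\<Sum>a\<in>A. \<Sum>b\<in>Basis. \<bar>w a \<bullet> b\<bar>))) \<partial>PiM A (\<lambda>_. std_gauss :: 'a::euclidean_space measure)) < \<infinity>"
proof -
  have [measurable]: "(\<lambda>w. \<Sum>a\<in>A. \<Sum>b\<in>Basis. \<bar>w a \<bullet> b\<bar>) \<in> borel_measurable (PiM A (\<lambda>_. std_gauss :: 'a measure))"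
    by measurable
  have "(\<integral>\<^sup>+w. ennreal (B * exp (k * (\<Sum>a\<in>A. \<Sum>b\<in>Basis. \<bar>w a \<bullet> b\<bar>))) \<partial>PiM A (\<lambda>_. std_gauss :: 'a measure)) =
    ennreal B * (\<integral>\<^sup>+w. ennreal (exp (k * (\<Sum>a\<in>A. \<Sum>b\<in>Basis. \<bar>w a \<bullet> b\<bar>))) \<partial>PiM A (\<lambda>_. std_gauss :: 'a measure))"
    by (subst nn_integral_cmult[symmetric]) (auto simp: ennreal_mult'')
  also have "\<dots> < \<infinity>"
    using nn_integral_PiM_std_gauss_exp_finite[OF assms, of k, where 'a='a]
    by (simp add: ennreal_mult_less_top)
  finally show ?thesis .
qed

lemma mean_abs_det_finite:
  assumes A: "finite A"
  shows "mean_abs_det A c < \<infinity>"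
proof -
  define C where "C = (\<Sum>a\<in>A. norm (c a))"
  have C: "C \<ge> 0" "\<bar>c a $ j\<bar> \<le> C" if "a \<in> A" for a j
  proof -
    have "\<bar>c a $ j\<bar> \<le> norm (c a)" by (rule component_le_norm_cart)
    also have "\<dots> \<le> C" unfolding C_def using A that by (intro member_le_sum) auto
    finally show "\<bar>c a $ j\<bar> \<le> C" .
  qed (simp add: C_def sum_nonneg)
  have "C \<ge> 0" by (simp add: C_def sum_nonneg)
  then have "mean_abs_det A c \<le> (\<integral>\<^sup>+w. ennreal (fact CARD('b) * C ^ CARD('b) * exp (real CARD('b) * (\<Sum>a\<in>A. \<Sum>b\<in>Basis. \<bar>w a \<bullet> b\<bar>)))
      \<partial>PiM A (\<lambda>_. std_gauss :: (real^'b) measure))"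
    unfolding mean_abs_det_def
    by (intro nn_integral_mono ennreal_leI abs_det_outer_sum_le[OF A]) (use C in auto)
  also have "\<dots> < \<infinity>" by (rule nn_integral_dominating_finite[OF A])
  finally show ?thesis .
qed

lemma mean_abs_det_tendsto:
  fixes c :: "nat \<Rightarrow> 'b \<Rightarrow> real^'n"
  assumes A: "finite A" and lim: "\<And>a. a \<in> A \<Longrightarrow> (\<lambda>k. c k a) \<longlonglongrightarrow> l a"
  shows "(\<lambda>k. mean_abs_det A (c k)) \<longlonglongrightarrow> mean_abs_det A l"
proof -
  have "\<forall>a\<in>A. \<exists>C. \<forall>k. norm (c k a) \<le> C"
  proof
    fix a assume "a \<in> A"
    then have "Bseq (\<lambda>k. c k a)" using lim by (intro convergent_imp_Bseq) (auto simp: convergent_def)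
    then show "\<exists>C. \<forall>k. norm (c k a) \<le> C" by (auto simp: Bseq_def)
  qed
  then obtain D where D: "\<And>a k. a \<in> A \<Longrightarrow> norm (c k a) \<le> D a" by metis
  have Dnn: "D a \<ge> 0" if "a \<in> A" for a using D[OF that, of 0] norm_ge_zero order_trans by blast
  define C where "C = (\<Sum>a\<in>A. D a)"
  have C0: "C \<ge> 0" using Dnn by (auto simp: C_def intro: sum_nonneg)
  have C: "\<bar>c k a $ j\<bar> \<le> C" if "a \<in> A" for a j k
  proof -
    have "\<bar>c k a $ j\<bar> \<le> norm (c k a)" by (rule component_le_norm_cart)
    also have "\<dots> \<le> D a" by (rule D[OF that])
    also have "\<dots> \<le> C" unfolding C_def using A that Dnn by (intro member_le_sum) auto
    finally show ?thesis .
  qed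
  let ?W = "\<lambda>w. ennreal (fact CARD('n) * C ^ CARD('n) * exp (real CARD('n) * (\<Sum>a\<in>A. \<Sum>b\<in>Basis. \<bar>w a \<bullet> b\<bar>)))"
  show ?thesis
    unfolding mean_abs_det_def
  proof (rule nn_integral_dominated_convergence[where w="?W"])
    show "?W \<in> borel_measurable (PiM A (\<lambda>_. std_gauss :: (real^'n) measure))" by measurable
    show "AE w in PiM A (\<lambda>_. std_gauss). ennreal \<bar>det (outer_sum A (c k) w)\<bar> \<le> ?W w" for k
      using C C0 by (intro AE_I2 ennreal_leI abs_det_outer_sum_le[OF A]) auto
    show "(\<integral>\<^sup>+w. ?W w \<partial>PiM A (\<lambda>_. std_gauss :: (real^'n) measure)) < \<infinity>"
      by (rule nn_integral_dominating_finite[OF A])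
    show "AE w in PiM A (\<lambda>_. std_gauss). (\<lambda>k. ennreal \<bar>det (outer_sum A (c k) w)\<bar>) \<longlonglongrightarrow> ennreal \<bar>det (outer_sum A l w)\<bar>"
      unfolding det_def outer_sum_def vec_lambda_beta
      by (intro AE_I2 tendsto_ennrealI tendsto_intros lim)
  qed (rule borel_measurable_abs_det_outer_sum)+
qed

text \<open>For \<open>w = c\<close> the matrix is the Gram-type sum of the \<open>c a\<close> with
  themselves, which is positive definite under \<open>span\<close>. The determinant therefore stays
  non-zero on a neighbourhood of \<open>c\<close>, and this has positive Gaussian measure.\<close>

lemma mean_abs_det_pos:
  fixes c :: "'b \<Rightarrow> real^'n"
  assumes A: "finite A" and span: "\<And>h. (\<And>a. a \<in> A \<Longrightarrow> c a \<bullet> h = 0) \<Longrightarrow> h = 0"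
  shows "mean_abs_det A c > 0"
proof -
  interpret G: product_sigma_finite "\<lambda>_. std_gauss :: (real^'n) measure" by (rule product_sigma_finite_std_gauss)
  have ker: "h = 0" if h: "outer_sum A c c *v h = 0" for h
  proof (rule span)
    have "(\<Sum>a\<in>A. (c a \<bullet> h)\<^sup>2) = (outer_sum A c c *v h) \<bullet> h"
      by (simp add: outer_sum_mult inner_sum_left power2_eq_square)
    then have "(\<Sum>a\<in>A. (c a \<bullet> h)\<^sup>2) = 0" by (simp add: h)
    then show "c a \<bullet> h = 0" if "a \<in> A" for a
      using A that by (simp add: sum_nonneg_eq_0_iff)
  qed
  then have det0: "det (outer_sum A c c) \<noteq> 0"
    using matrix_left_invertible_ker[of "outer_sum A c c"]
    by (simp add: invertible_det_nz[symmetric] invertible_left_inverse)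
  define V where "V = {w :: 'b \<Rightarrow> real^'n. det (outer_sum A c w) \<noteq> 0}"
  have "continuous_on UNIV (\<lambda>w. det (outer_sum A c w))"
    unfolding det_def outer_sum_def vec_lambda_beta
    by (intro continuous_intros continuous_on_product_coordinates)
  then have "open V"
    using open_vimage[OF open_Compl[OF closed_singleton], of "\<lambda>w. det (outer_sum A c w)" 0]
    by (simp add: V_def vimage_def)
  moreover have "c \<in> V" using det0 by (simp add: V_def)
  \<comment> \<open>The topology on functions is the product topology, so the neighbourhood contains
    a product of open sets, indexed by the whole type and not only by \<open>A\<close>.\<close>
  ultimately obtain X where X: "c \<in> (\<Pi>\<^sub>E i\<in>UNIV. X i)" "\<And>i. open (X i)" "(\<Pi>\<^sub>E i\<in>UNIV. X i) \<subseteq> V"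
    using product_topology_open_contains_basis[of "\<lambda>_. euclidean" UNIV V c]
    by (auto simp: open_fun_def)
  have Xpos: "emeasure std_gauss (X a) > 0" for a
  proof (rule ccontr)
    assume "\<not> emeasure std_gauss (X a) > 0"
    then have "(\<integral>\<^sup>+y. ennreal (gauss_density y) * indicator (X a) y \<partial>lborel) = 0"
      using X(2)[of a] by (simp add: std_gauss_def emeasure_density)
    then have "AE y in lborel. ennreal (gauss_density y) * indicator (X a) y = 0"
      using X(2)[of a] by (subst (asm) nn_integral_0_iff_AE) auto
    then have "AE y in lborel. y \<notin> X a"
      by eventually_elim (auto simp: indicator_def gauss_density_pos[THEN less_imp_neq, symmetric] split: if_splits)
    then have "X a \<in> null_sets lborel"
      using X(2)[of a] by (subst (asm) AE_iff_null_sets[symmetric]) auto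
    then have "negligible (X a)"
      by (simp add: negligible_iff_null_sets null_sets_completionI)
    moreover have "X a \<noteq> {}" using X(1) by auto
    ultimately show False using X(2)[of a] open_not_negligible by blast
  qed
  have sub: "Pi\<^sub>E A X \<subseteq> {w. det (outer_sum A c w) \<noteq> 0}"
  proof
    fix w assume w: "w \<in> Pi\<^sub>E A X"
    \<comment> \<open>\<open>outer_sum A\<close> reads only the coordinates in \<open>A\<close>, so
      the others may be filled with those of \<open>c\<close>, which lie in their factors.\<close>
    define w' where "w' = (\<lambda>i. if i \<in> A then w i else c i)"
    have "w' \<in> (\<Pi>\<^sub>E i\<in>UNIV. X i)" using w X(1) by (auto simp: w'_def PiE_iff)
    then have "w' \<in> V" using X(3) by auto
    moreover have "outer_sum A c w' = outer_sum A c w" by (simp add: outer_sum_def w'_def)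
    ultimately show "w \<in> {w. det (outer_sum A c w) \<noteq> 0}" by (simp add: V_def)
  qed
  have PX: "Pi\<^sub>E A X \<in> sets (PiM A (\<lambda>_. std_gauss))"
    using A X(2) by (intro sets_PiM_I_finite) auto
  show ?thesis
  proof (rule ccontr)
    assume "\<not> mean_abs_det A c > 0"
    then have "AE w in PiM A (\<lambda>_. std_gauss). ennreal \<bar>det (outer_sum A c w)\<bar> = 0"
      unfolding mean_abs_det_def
      using nn_integral_0_iff_AE[OF borel_measurable_abs_det_outer_sum[of A c]] by simp
    then have "AE w in PiM A (\<lambda>_. std_gauss). w \<notin> Pi\<^sub>E A X"
      by eventually_elim (use sub in auto)
    then have "emeasure (PiM A (\<lambda>_. std_gauss)) (Pi\<^sub>E A X) = 0"
      using PX by (simp add: AE_iff_null_sets[symmetric] null_setsD1)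
    moreover have "emeasure (PiM A (\<lambda>_. std_gauss)) (Pi\<^sub>E A X) = (\<Prod>a\<in>A. emeasure std_gauss (X a))"
      using X(2) by (intro G.emeasure_PiM A) auto
    ultimately show False using Xpos A by (simp add: prod_zero_iff less_imp_neq[symmetric])
  qed
qed

text \<open>A zero vector \<open>c b\<close> silences the Gaussian vector at \<open>b\<close>, which
  then integrates to 1. It is applied to the additional exponent at the point where this coincides
  with the weighted mean.\<close>

lemma mean_abs_det_insert_zero:
  assumes A: "finite A" "b \<notin> A" and c: "c b = 0"
  shows "mean_abs_det (insert b A) c = mean_abs_det A c"
proof -
  interpret G: product_sigma_finite "\<lambda>_. std_gauss :: (real^'b) measure" by (rule product_sigma_finite_std_gauss)
  interpret P: prob_space "std_gauss :: (real^'b) measure" by (rule prob_space_std_gauss)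
  have eq: "outer_sum (insert b A) c (w(b := y)) = outer_sum A c w" for w y
  proof -
    have "(\<Sum>a\<in>A. (w(b := y)) a $ i * c a $ j) = (\<Sum>a\<in>A. w a $ i * c a $ j)" for i j
      using A by (intro sum.cong) auto
    then show ?thesis using A c by (simp add: outer_sum_def)
  qed
  show ?thesis
    unfolding mean_abs_det_def
    by (subst G.product_nn_integral_insert[OF A borel_measurable_abs_det_outer_sum])
       (simp only: eq nn_integral_const P.emeasure_space_1 mult_1_right)
qed

subsection \<open>Comparison at a critical point\<close>

text \<open>If all points of \<open>A\<close> failed the inequality in direction \<open>x\<close>,
  an open half-space would contain the hull but miss a point of the ball around \<open>a0\<close>.
  The bound gives coercivity when the weighted mean is constructed, and non-degeneracy of the
  determinant later.\<close>

lemma interior_convex_hull_support: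
  fixes a0 :: "'a::euclidean_space"
  assumes "a0 \<in> interior (convex hull A)"
  obtains e where "e > 0" "\<And>x. \<exists>a\<in>A. (a - a0) \<bullet> x \<ge> e * norm x"
proof -
  obtain e where e: "e > 0" "cball a0 e \<subseteq> convex hull A"
    using assms by (meson mem_interior_cball)
  have "\<exists>a\<in>A. (a - a0) \<bullet> x \<ge> e * norm x" for x
  proof (rule ccontr)
    assume neg: "\<not> (\<exists>a\<in>A. (a - a0) \<bullet> x \<ge> e * norm x)"
    have "A \<subseteq> {y. x \<bullet> y < x \<bullet> a0 + e * norm x}"
    proof
      fix a assume "a \<in> A"
      with neg have "(a - a0) \<bullet> x < e * norm x" by (auto simp: not_le)
      then show "a \<in> {y. x \<bullet> y < x \<bullet> a0 + e * norm x}"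
        by (simp add: inner_diff_left inner_commute[of x])
    qed
    then have hull: "convex hull A \<subseteq> {y. x \<bullet> y < x \<bullet> a0 + e * norm x}"
      by (rule hull_minimal) (rule convex_halfspace_lt)
    \<comment> \<open>For \<open>x = 0\<close> the quotient is 0 and the point is \<open>a0\<close>;
      the half-space is then empty, which is still contradictory.\<close>
    have "a0 + (e / norm x) *\<^sub>R x \<in> cball a0 e"
      using e(1) by (simp add: dist_norm)
    then have "x \<bullet> (a0 + (e / norm x) *\<^sub>R x) < x \<bullet> a0 + e * norm x"
      using e(2) hull by blast
    moreover have "x \<bullet> (a0 + (e / norm x) *\<^sub>R x) = x \<bullet> a0 + e * norm x"
      by (cases "x = 0") (simp_all add: inner_add_right dot_square_norm power2_eq_square)
    ultimately show False by simp
  qed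
  with e(1) that show thesis by blast
qed

text \<open>The point is the minimiser of \<open>exp_var A \<alpha> x * exp (- 2 * (a0 \<bullet> x))\<close>, which is
  coercive because \<open>a0\<close> is an interior point of the hull.\<close>

lemma exp_weighted_mean_surj:
  fixes a0 :: "real^'n"
  assumes A: "finite A" and \<alpha>: "\<And>a. a \<in> A \<Longrightarrow> \<alpha> a > 0"
    and int: "a0 \<in> interior (convex hull A)"
  obtains x where "(\<Sum>a\<in>A. (exp_coeff \<alpha> x a)\<^sup>2 *\<^sub>R (a - a0)) = 0"
proof -
  obtain e where e: "e > 0" "\<And>x. \<exists>a\<in>A. (a - a0) \<bullet> x \<ge> e * norm x"
    using interior_convex_hull_support[OF int] by blast
  have ne: "A \<noteq> {}" using int by auto
  define f where "f x = (\<Sum>a\<in>A. (\<alpha> a)\<^sup>2 * exp (2 * ((a - a0) \<bullet> x)))" for x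
  define m where "m = Min ((\<lambda>a. (\<alpha> a)\<^sup>2) ` A)"
  have m_le: "m \<le> (\<alpha> a)\<^sup>2" if "a \<in> A" for a
    unfolding m_def using A that by (intro Min_le) auto
  have "m \<in> (\<lambda>a. (\<alpha> a)\<^sup>2) ` A" unfolding m_def using A ne by (intro Min_in) auto
  then have m: "m > 0" using \<alpha> by auto (metis less_irrefl)
  have lower: "m * (2 * e * norm x) \<le> f x" for x
  proof -
    obtain a where a: "a \<in> A" "(a - a0) \<bullet> x \<ge> e * norm x" using e(2) by blast
    have "m * (2 * e * norm x) \<le> (\<alpha> a)\<^sup>2 * exp (2 * ((a - a0) \<bullet> x))"
    proof (rule mult_mono)
      have "2 * e * norm x \<le> 2 * ((a - a0) \<bullet> x)" using a(2) by simp
      also have "\<dots> \<le> exp (2 * ((a - a0) \<bullet> x))"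
        using exp_ge_add_one_self[of "2 * ((a - a0) \<bullet> x)"] by linarith
      finally show "2 * e * norm x \<le> exp (2 * ((a - a0) \<bullet> x))" .
    qed (use m_le[OF a(1)] e(1) in auto)
    also have "\<dots> \<le> f x" unfolding f_def using A a(1) by (intro member_le_sum) auto
    finally show ?thesis .
  qed
  \<comment> \<open>Outside the ball of radius \<open>R\<close> the linear lower bound is at least
    \<open>f 0\<close>, so a minimum over the ball is global. The summand 1 makes \<open>R\<close>
    positive even when the quotient is only known to be non-negative.\<close>
  define R where "R = f 0 / (2 * e * m) + 1"
  have f0: "f 0 \<ge> 0" by (auto simp: f_def intro: sum_nonneg)
  have R: "R > 0" using f0 e(1) m by (simp add: R_def add_nonneg_pos)
  have "continuous_on (cball 0 R) f" unfolding f_def by (intro continuous_intros)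
  then obtain x where x: "x \<in> cball 0 R" "\<And>y. y \<in> cball 0 R \<Longrightarrow> f x \<le> f y"
    using continuous_attains_inf[of "cball 0 R" f] R by auto
  have min: "f x \<le> f y" for y
  proof (cases "y \<in> cball 0 R")
    case False
    then have "norm y > R" by simp
    have "f x \<le> f 0" using x(2)[of 0] R by simp
    also have "f 0 \<le> m * (2 * e * R)" using e(1) m by (simp add: R_def field_simps)
    also have "\<dots> \<le> m * (2 * e * norm y)" using \<open>norm y > R\<close> e(1) m by simp
    also have "\<dots> \<le> f y" by (rule lower)
    finally show ?thesis .
  qed (rule x(2))
  have der: "(f has_derivative (\<lambda>h. \<Sum>a\<in>A. (\<alpha> a)\<^sup>2 * (exp (2 * ((a - a0) \<bullet> x)) * (2 * ((a - a0) \<bullet> h))))) (at x)"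
    unfolding f_def by (auto intro!: derivative_eq_intros simp: mult_ac)
  have "(\<lambda>h. \<Sum>a\<in>A. (\<alpha> a)\<^sup>2 * (exp (2 * ((a - a0) \<bullet> x)) * (2 * ((a - a0) \<bullet> h)))) = (\<lambda>h. 0)"
    by (rule differential_zero_maxmin[of x UNIV f]) (use der min in auto)
  then have crit: "(\<Sum>a\<in>A. (\<alpha> a)\<^sup>2 * (exp (2 * ((a - a0) \<bullet> x)) * (2 * ((a - a0) \<bullet> h)))) = 0" for h
    by (metis (mono_tags))
  have "(\<Sum>a\<in>A. (exp_coeff \<alpha> x a)\<^sup>2 *\<^sub>R (a - a0)) \<bullet> h = 0" for h
  proof -
    \<comment> \<open>The tilt by \<open>a0\<close> and the factor 2 from differentiation are common
      to all terms, so they come out of the critical point equation.\<close>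
    have "(exp_coeff \<alpha> x a)\<^sup>2 * ((a - a0) \<bullet> h) =
       exp (2 * (a0 \<bullet> x)) / 2 * ((\<alpha> a)\<^sup>2 * (exp (2 * ((a - a0) \<bullet> x)) * (2 * ((a - a0) \<bullet> h))))" for a
    proof -
      have "(exp (a \<bullet> x))\<^sup>2 = exp (2 * (a0 \<bullet> x)) * exp (2 * ((a - a0) \<bullet> x))"
        by (simp add: exp_add[symmetric] power2_eq_square inner_diff_left)
      then show ?thesis by (simp add: exp_coeff_def power_mult_distrib)
    qed
    then have "(\<Sum>a\<in>A. (exp_coeff \<alpha> x a)\<^sup>2 *\<^sub>R (a - a0)) \<bullet> h =
       exp (2 * (a0 \<bullet> x)) / 2 * (\<Sum>a\<in>A. (\<alpha> a)\<^sup>2 * (exp (2 * ((a - a0) \<bullet> x)) * (2 * ((a - a0) \<bullet> h))))"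
      by (simp only: inner_sum_left inner_scaleR_left sum_distrib_left)
    then show ?thesis by (simp only: crit mult_zero_right)
  qed
  then have "(\<Sum>a\<in>A. (exp_coeff \<alpha> x a)\<^sup>2 *\<^sub>R (a - a0)) = 0"
    by (metis inner_eq_zero_iff)
  then show thesis by (rule that)
qed

lemma exp_mean_eqI:
  assumes "exp_var A \<alpha> x \<noteq> 0" "(\<Sum>a\<in>A. (exp_coeff \<alpha> x a)\<^sup>2 *\<^sub>R (a - y)) = 0"
  shows "exp_mean A \<alpha> x = y"
proof -
  have "(\<Sum>a\<in>A. (exp_coeff \<alpha> x a)\<^sup>2 *\<^sub>R a) = exp_var A \<alpha> x *\<^sub>R y"
    using assms(2) by (simp add: scaleR_diff_right sum_subtractf scaleR_sum_left exp_var_def)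
  then show ?thesis using assms(1) by (simp add: exp_mean_def)
qed

section \<open>Continuity of the density and passage to a ball\<close>

lemma isCont_zero_density:
  assumes A: "finite A" "A \<noteq> {}" and \<alpha>: "\<And>a. a \<in> A \<Longrightarrow> \<alpha> a > 0"
  shows "isCont (zero_density A \<alpha>) (x :: real^'n)"
proof -
  have v: "isCont (\<lambda>x. exp_coeff \<alpha> x a) x" for a
    unfolding exp_coeff_def by (intro continuous_intros)
  have K: "exp_var A \<alpha> x > 0" for x by (rule exp_var_pos[OF A \<alpha>])
  have Kc: "isCont (exp_var A \<alpha>) x"
    unfolding exp_var_def[abs_def] by (intro continuous_intros v)
  have "isCont (exp_mean A \<alpha>) x"
    unfolding exp_mean_def[abs_def] using K[of x] by (intro continuous_intros v Kc) auto
  then have c: "isCont (\<lambda>x. exp_coeff \<alpha> x a *\<^sub>R (a - exp_mean A \<alpha> x)) x" for a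
    by (intro continuous_intros v)
  have p: "isCont (\<lambda>x. (1 / sqrt (2 * pi * exp_var A \<alpha> x)) ^ CARD('n)) x"
    using K[of x] by (intro continuous_intros Kc) auto
  show ?thesis
    unfolding continuous_at_sequentially
  proof (intro allI impI)
    fix X :: "nat \<Rightarrow> real^'n" assume X: "X \<longlonglongrightarrow> x"
    have "(\<lambda>k. ennreal ((1 / sqrt (2 * pi * exp_var A \<alpha> (X k))) ^ CARD('n)) *
        mean_abs_det A (\<lambda>a. exp_coeff \<alpha> (X k) a *\<^sub>R (a - exp_mean A \<alpha> (X k)))) \<longlonglongrightarrow> zero_density A \<alpha> x"
      unfolding zero_density_def
    \<comment> \<open>Products in \<open>ennreal\<close> need not converge when one limit is 0 and
      the other infinite; finiteness of the mean determinant and of the prefactor excludes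
      this.\<close>
    proof (rule tendsto_mult_ennreal)
      show "(\<lambda>k. ennreal ((1 / sqrt (2 * pi * exp_var A \<alpha> (X k))) ^ CARD('n))) \<longlonglongrightarrow>
        ennreal ((1 / sqrt (2 * pi * exp_var A \<alpha> x)) ^ CARD('n))"
        by (rule tendsto_ennrealI) (rule isCont_tendsto_compose[OF p X])
      show "(\<lambda>k. mean_abs_det A (\<lambda>a. exp_coeff \<alpha> (X k) a *\<^sub>R (a - exp_mean A \<alpha> (X k)))) \<longlonglongrightarrow>
        mean_abs_det A (\<lambda>a. exp_coeff \<alpha> x a *\<^sub>R (a - exp_mean A \<alpha> x))"
        by (rule mean_abs_det_tendsto[OF A(1)]) (rule isCont_tendsto_compose[OF c X])
    qed (use mean_abs_det_finite[OF A(1)] in \<open>auto simp: less_top\<close>)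
    then show "(zero_density A \<alpha> \<circ> X) \<longlonglongrightarrow> zero_density A \<alpha> x"
      by (simp add: o_def zero_density_def)
  qed
qed

text \<open>Constants \<open>s\<close> and \<open>t\<close> with a gap between them turn the
  pointwise inequality into a strict inequality of integrals: these are compared with multiples of
  the volume of the ball.\<close>

lemma isCont_less_ball:
  fixes f g :: "'a::metric_space \<Rightarrow> ennreal"
  assumes f: "isCont f x" and g: "isCont g x" and less: "f x < g x"
  obtains d s t where "d > 0" "s < t" "\<And>y. y \<in> ball x d \<Longrightarrow> f y \<le> s" "\<And>y. y \<in> ball x d \<Longrightarrow> t \<le> g y"
proof -
  obtain t where t: "f x < t" "t < g x" using less dense by blast
  obtain s where s: "f x < s" "s < t" using t(1) dense by blast
  have "\<forall>\<^sub>F y in nhds x. f y < s"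
    using f s(1) by (auto simp: continuous_at_imp_continuous_at_within isCont_def tendsto_at_iff_tendsto_nhds intro: order_tendstoD)
  moreover have "\<forall>\<^sub>F y in nhds x. t < g y"
    using g t(2) by (auto simp: isCont_def tendsto_at_iff_tendsto_nhds intro: order_tendstoD)
  ultimately have "\<forall>\<^sub>F y in nhds x. f y < s \<and> t < g y" by (rule eventually_conj)
  then obtain d where "d > 0" "\<And>y. dist y x < d \<Longrightarrow> f y < s \<and> t < g y"
    unfolding eventually_nhds_metric by blast
  with s(2) that[of d s t] show thesis by (auto simp: dist_commute less_imp_le)
qed

text \<open>This carries independence from the index set with \<open>None\<close> for the additional
  coefficient over to families indexed by the exponents themselves.\<close>

lemma (in prob_space) indep_vars_reindex:
  assumes X: "indep_vars (\<lambda>_. N) X (f ` I)" and f: "inj_on f I"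
  shows "indep_vars (\<lambda>_. N) (\<lambda>i. X (f i)) I"
proof -
  have "indep_vars (\<lambda>i. PiM {f i} (\<lambda>_. N)) (\<lambda>i \<omega>. restrict (\<lambda>j. X j \<omega>) {f i}) I"
    using f by (intro indep_vars_restrict[OF X]) (auto simp: disjoint_family_on_def inj_on_def)
  then have "indep_vars (\<lambda>_. N) (\<lambda>i \<omega>. (\<lambda>g. g (f i)) (restrict (\<lambda>j. X j \<omega>) {f i})) I"
    by (rule indep_vars_compose2) (auto intro: measurable_component_singleton)
  then show ?thesis by simp
qed

theorem theorem2:
  fixes A :: "(real ^ 'n) set"
    and \<alpha> :: "real ^ 'n \<Rightarrow> real"
    and a\<^sub>0 :: "real ^ 'n"
    and \<alpha>\<^sub>0 :: real
    and M :: "'w measure"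
    and \<xi> :: "real ^ 'n \<Rightarrow> 'w \<Rightarrow> real"
    and \<xi>\<^sub>0 :: "'w \<Rightarrow> real"
  assumes "finite A"
    and "aff_dim (convex hull A) = int CARD('n)"
    and "\<And>a. a \<in> A \<Longrightarrow> \<alpha> a > 0"
    and "a\<^sub>0 \<notin> A"
    and "\<alpha>\<^sub>0 > 0"
    and "prob_space M"
    and "prob_space.indep_vars M (\<lambda>_. borel) (case_option \<xi>\<^sub>0 \<xi>) (insert None (Some ` A))"
    and "\<And>a. a \<in> A \<Longrightarrow> distributed M lborel (\<xi> a) std_normal_density"
    and "distributed M lborel \<xi>\<^sub>0 std_normal_density"
    and "a\<^sub>0 \<in> interior (convex hull A)"
  shows "\<exists>U. open U \<and> U \<noteq> {} \<and>
    ES M (\<lambda>\<omega> x. exp_sum A \<alpha> \<xi> \<omega> x + \<xi>\<^sub>0 \<omega> * \<alpha>\<^sub>0 * exp (a\<^sub>0 \<bullet> x)) U < ES M (exp_sum A \<alpha> \<xi>) U"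
proof -
  interpret M: prob_space M by fact
  have A: "finite A" "A \<noteq> {}" using assms(1,10) by auto
  \<comment> \<open>The enlarged sum is itself an exponential sum, over \<open>A'\<close>, so one
    density formula covers both sides.\<close>
  define A' where "A' = insert a\<^sub>0 A"
  define \<alpha>' where "\<alpha>' = (\<lambda>a. if a = a\<^sub>0 then \<alpha>\<^sub>0 else \<alpha> a)"
  define \<xi>' where "\<xi>' = (\<lambda>a. if a = a\<^sub>0 then \<xi>\<^sub>0 else \<xi> a)"
  have A': "finite A'" "A' \<noteq> {}" using A by (auto simp: A'_def)
  have \<alpha>': "\<alpha>' a > 0" if "a \<in> A'" for a using that assms(3,5) by (auto simp: A'_def \<alpha>'_def)
  have sum': "(\<Sum>a\<in>A'. F a) = (\<Sum>a\<in>A. F a) + F a\<^sub>0" for F :: "real^'n \<Rightarrow> 'z::comm_monoid_add"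
    using A assms(4) by (simp add: A'_def add.commute)
  have E0: "(\<lambda>\<omega> x. exp_sum A \<alpha> \<xi> \<omega> x + \<xi>\<^sub>0 \<omega> * \<alpha>\<^sub>0 * exp (a\<^sub>0 \<bullet> x)) = exp_sum A' \<alpha>' \<xi>'"
  proof (intro ext)
    fix \<omega> x
    have "(\<Sum>a\<in>A. \<xi>' a \<omega> * \<alpha>' a * exp (a \<bullet> x)) = (\<Sum>a\<in>A. \<xi> a \<omega> * \<alpha> a * exp (a \<bullet> x))"
      using assms(4) by (intro sum.cong) (auto simp: \<xi>'_def \<alpha>'_def)
    then show "exp_sum A \<alpha> \<xi> \<omega> x + \<xi>\<^sub>0 \<omega> * \<alpha>\<^sub>0 * exp (a\<^sub>0 \<bullet> x) = exp_sum A' \<alpha>' \<xi>' \<omega> x"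
      by (simp add: exp_sum_def sum') (simp add: \<xi>'_def \<alpha>'_def)
  qed
  have indep: "M.indep_vars (\<lambda>_. borel) \<xi> A"
  proof -
    have "M.indep_vars (\<lambda>_. borel) (case_option \<xi>\<^sub>0 \<xi>) (Some ` A)"
      by (rule M.indep_vars_subset[OF assms(7)]) auto
    then have "M.indep_vars (\<lambda>_. borel) (\<lambda>a. case_option \<xi>\<^sub>0 \<xi> (Some a)) A"
      by (rule M.indep_vars_reindex) simp
    then show ?thesis by simp
  qed
  have indep': "M.indep_vars (\<lambda>_. borel) \<xi>' A'"
  proof -
    \<comment> \<open>Since \<open>a\<^sub>0 \<notin> A\<close>, the image of \<open>A'\<close>
      under this injection is exactly the index set of the independence hypothesis.\<close>
    let ?f = "\<lambda>a. if a = a\<^sub>0 then None else Some a"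
    have "?f ` A' = insert None (Some ` A)" using assms(4) by (auto simp: A'_def image_iff)
    then have "M.indep_vars (\<lambda>_. borel) (case_option \<xi>\<^sub>0 \<xi>) (?f ` A')" using assms(7) by simp
    then have "M.indep_vars (\<lambda>_. borel) (\<lambda>a. case_option \<xi>\<^sub>0 \<xi> (?f a)) A'"
      by (rule M.indep_vars_reindex) (auto simp: inj_on_def)
    moreover have "(\<lambda>a. case_option \<xi>\<^sub>0 \<xi> (?f a)) = \<xi>'" by (auto simp: \<xi>'_def fun_eq_iff)
    ultimately show ?thesis by simp
  qed
  have dist': "distributed M lborel (\<xi>' a) std_normal_density" if "a \<in> A'" for a
    using that assms(8,9) by (auto simp: A'_def \<xi>'_def)
  obtain z where z: "(\<Sum>a\<in>A. (exp_coeff \<alpha> z a)\<^sup>2 *\<^sub>R (a - a\<^sub>0)) = 0"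
    using exp_weighted_mean_surj[of A \<alpha> a\<^sub>0] A(1) assms(3,10) by blast
  have K: "exp_var A \<alpha> z > 0" using A assms(3) by (rule exp_var_pos)
  have coeff': "exp_coeff \<alpha>' z a = exp_coeff \<alpha> z a" if "a \<in> A" for a
    using that assms(4) by (auto simp: exp_coeff_def \<alpha>'_def)
  \<comment> \<open>The gain is the square of the additional coefficient at \<open>z\<close>. It is
    the only effect of the new term there, as the mean and the determinant factor are
    unchanged.\<close>
  have K': "exp_var A' \<alpha>' z > exp_var A \<alpha> z"
    using coeff' assms(5) by (simp add: exp_var_def sum') (simp add: exp_coeff_def \<alpha>'_def)
  have mean: "exp_mean A \<alpha> z = a\<^sub>0" using K z by (intro exp_mean_eqI) auto
  have mean': "exp_mean A' \<alpha>' z = a\<^sub>0" using K K' z coeff' by (intro exp_mean_eqI) (auto simp: sum')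
  define D where "D = mean_abs_det A (\<lambda>a. exp_coeff \<alpha> z a *\<^sub>R (a - a\<^sub>0))"
  have D': "mean_abs_det A' (\<lambda>a. exp_coeff \<alpha>' z a *\<^sub>R (a - a\<^sub>0)) = D"
  proof -
    have "mean_abs_det A' (\<lambda>a. exp_coeff \<alpha>' z a *\<^sub>R (a - a\<^sub>0)) = mean_abs_det A (\<lambda>a. exp_coeff \<alpha>' z a *\<^sub>R (a - a\<^sub>0))"
      unfolding A'_def by (rule mean_abs_det_insert_zero) (use A assms(4) in auto)
    also have "\<dots> = D"
      unfolding D_def mean_abs_det_def outer_sum_def by (simp add: coeff')
    finally show ?thesis .
  qed
  \<comment> \<open>Multiplication by a common factor is strictly monotone in \<open>ennreal\<close>
    if the factor is finite and non-zero, so both bounds on \<open>D\<close> are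
    established.\<close>
  have D_fin: "D < \<infinity>" unfolding D_def by (rule mean_abs_det_finite[OF A(1)])
  have D_pos: "D > 0"
    unfolding D_def
  proof (rule mean_abs_det_pos[OF A(1)])
    fix h assume h: "\<And>a. a \<in> A \<Longrightarrow> (exp_coeff \<alpha> z a *\<^sub>R (a - a\<^sub>0)) \<bullet> h = 0"
    obtain e where e: "e > 0" "\<And>x. \<exists>a\<in>A. (a - a\<^sub>0) \<bullet> x \<ge> e * norm x"
      using interior_convex_hull_support[OF assms(10)] by blast
    obtain a where a: "a \<in> A" "(a - a\<^sub>0) \<bullet> h \<ge> e * norm h" using e(2) by blast
    have "(a - a\<^sub>0) \<bullet> h = 0" using h[OF a(1)] exp_coeff_pos[of \<alpha> a z] assms(3)[OF a(1)] by simp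
    with a(2) have "e * norm h \<le> 0" by simp
    with e(1) show "h = 0" by (simp add: mult_le_0_iff)
  qed
  have "zero_density A' \<alpha>' z < zero_density A \<alpha> z"
  proof -
    have "(1 / sqrt (2 * pi * exp_var A' \<alpha>' z)) ^ CARD('n) < (1 / sqrt (2 * pi * exp_var A \<alpha> z)) ^ CARD('n)"
      using K K' by (intro power_strict_mono divide_strict_left_mono) auto
    then have "ennreal ((1 / sqrt (2 * pi * exp_var A' \<alpha>' z)) ^ CARD('n)) < ennreal ((1 / sqrt (2 * pi * exp_var A \<alpha> z)) ^ CARD('n))"
      using K K' by (intro ennreal_lessI) auto
    then show ?thesis
      unfolding zero_density_def mean mean' D' D_def[symmetric]
      using D_fin D_pos by (intro ennreal_mult_strict_right_mono) auto
  qed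
  then obtain d s t where d: "d > 0" and st: "s < t"
    and s: "\<And>y. y \<in> ball z d \<Longrightarrow> zero_density A' \<alpha>' y \<le> s"
    and t: "\<And>y. y \<in> ball z d \<Longrightarrow> t \<le> zero_density A \<alpha> y"
    using isCont_less_ball[of z "zero_density A' \<alpha>'" "zero_density A \<alpha>"]
      isCont_zero_density[of A' \<alpha>' z] isCont_zero_density[of A \<alpha> z] A A' \<alpha>' assms(3) by blast
  let ?U = "ball z d"
  have "ES M (exp_sum A' \<alpha>' \<xi>') ?U = (\<integral>\<^sup>+x. zero_density A' \<alpha>' x * indicator ?U x \<partial>lborel)"
    using assms(6) A' \<alpha>' indep' dist' by (intro ES_exp_sum_eq_zero_density) auto
  also have "\<dots> \<le> (\<integral>\<^sup>+x. s * indicator ?U x \<partial>lborel)"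
    using s by (intro nn_integral_mono) (auto simp: indicator_def)
  also have "\<dots> = s * emeasure lborel ?U" by (simp add: nn_integral_cmult_indicator)
  \<comment> \<open>The gap between \<open>s\<close> and \<open>t\<close> survives because the ball
    has finite and positive volume.\<close>
  also have "\<dots> < t * emeasure lborel ?U"
  proof (rule ennreal_mult_strict_right_mono[OF st])
    show "emeasure lborel ?U < top" using emeasure_lborel_ball_finite[of z d] by simp
    show "0 < emeasure lborel ?U"
      using open_not_negligible[of ?U] d negligible_iff_null_sets[of ?U] null_sets_completionI[of ?U lborel]
      by (auto simp: zero_less_iff_neq_zero null_sets_def)
  qed
  also have "t * emeasure lborel ?U = (\<integral>\<^sup>+x. t * indicator ?U x \<partial>lborel)"
    by (simp add: nn_integral_cmult_indicator)
  also have "\<dots> \<le> (\<integral>\<^sup>+x. zero_density A \<alpha> x * indicator ?U x \<partial>lborel)"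
    using t by (intro nn_integral_mono) (auto simp: indicator_def)
  also have "\<dots> = ES M (exp_sum A \<alpha> \<xi>) ?U"
    using assms(6) A assms(3) indep assms(8) by (intro ES_exp_sum_eq_zero_density[symmetric]) auto
  finally have "ES M (exp_sum A' \<alpha>' \<xi>') ?U < ES M (exp_sum A \<alpha> \<xi>) ?U" .
  then show ?thesis
    unfolding E0 using d by (intro exI[of _ ?U]) auto
qed

end
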